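(* Let $H$, $J$, $A$ and the Dirac operator $D=D_0+D_1+D_R$ be as in the context, and suppose $\delta_{21}=0$ and $\beta_{13}=\beta_{14}=0$. Then the Hodge property $\mathcal{C}\ell_D(A)'=\mathcal{C}\ell_D(A)^\circ$ holds if and only if $(\beta_{23},\beta_{24})\neq(0,0)$ and at least three of the four vectors $(\alpha_{13},\alpha_{14})$, $(\alpha_{23},\alpha_{24})$, $(\delta_{12},\delta_{13},\delta_{14})$, $(\delta_{22},\delta_{23},\delta_{24})$ are non-zero.
   Context: Let $H=M_4(\mathbb{C})\oplus M_4(\mathbb{C})$, with elements written as pairs $(v,w)$ and inner product $\langle (v,w),(v',w')\rangle=\mathrm{Tr}(v^*v')+\mathrm{Tr}(w^*w')$. Let $J$ be the antilinear isometry $J(v,w)=(w^*,v^* )$. Identify $\mathrm{End}_{\mathbb{C}}(H)$ with $M_4(\mathbb{C})\otimes M_2(\mathbb{C})\otimes M_4(\mathbb{C})$ via $\big(x\otimes\begin{bmatrix}a&b\\c&d\end{bmatrix}\otimes y\big)(v,w)=\big(x(av+bw)y^t,\ x(cv+dw)y^t\big)$. Here $e_{ij}$ denotes the matrix unit with $1$ in position $(i,j)$ (size clear from context) and $1$ the identity matrix. Let $A\cong\mathbb{C}\oplus\mathbb{H}\oplus M_3(\mathbb{C})$ be the real $*$-algebra of operators $\mathrm{diag}(\lambda,\bar\lambda,q)\otimes e_{11}\otimes 1+\mathrm{diag}(\lambda,m)\otimes e_{22}\otimes 1$, where $\lambda\in\mathbb{C}$, $q$ is a quaternion viewed as a $2\times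 2$ complex matrix $\begin{bmatrix}z&w\\-\bar w&\bar z\end{bmatrix}$, $m\in M_3(\mathbb{C})$, and $\mathrm{diag}$ denotes block-diagonal $4\times4$ matrices. Fix complex parameters $\alpha_{ij},\beta_{ij}$ ($i\in\{1,2\}$, $j\in\{3,4\}$), $\delta_{12},\delta_{13},\delta_{14},\delta_{21},\delta_{22},\delta_{23},\delta_{24}$ and $\Upsilon_R$. Put $\alpha=\begin{bmatrix}\alpha_{13}&\alpha_{14}\\ \alpha_{23}&\alpha_{24}\end{bmatrix}$, $\beta=\begin{bmatrix}\beta_{13}&\beta_{14}\\ \beta_{23}&\beta_{24}\end{bmatrix}$, $X_\alpha=\begin{bmatrix}0&\alpha\\ \alpha^*&0\end{bmatrix}\in M_4(\mathbb{C})$ (in $2\times2$ blocks), $X_\beta$ likewise, and $Y\in M_4(\mathbb{C})$ the matrix with first row $(0,\delta_{12},\delta_{13},\delta_{14})$, second row $(\delta_{21},\delta_{22},\delta_{23},\delta_{24})$ and zero third and fourth rows. Define $D_0=X_\alpha\otimes e_{11}\otimes e_{11}+X_\beta\otimes e_{11}\otimes(1-e_{11})+Y\otimes e_{12}\otimes e_{11}+Y^*\otimes e_{21}\otimes e_{11}$, $D_1=JD_0J^{-1}$, $D_R=e_{11}\otimes(\Upsilon_R e_{21}+\overline{\Upsilon}_R e_{12})\otimes e_{11}$, and $D=D_0+D_1+D_R$. For $\xi\in\mathrm{End}_{\mathbb{C}}(H)$ set $\xi^\circ=J\xi^*J^{-1}$, and for a subset $S$ set $S^\circ=\{\xi^\circ:\xi\in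 S\}$ and $S'=\{\xi\in\mathrm{End}_{\mathbb{C}}(H): [\xi,\eta]=0\ \forall\eta\in S\}$. $\mathcal{C}\ell_D(A)$ is the complex $*$-subalgebra of $\mathrm{End}_{\mathbb{C}}(H)$ generated by $A$ and the operators $a[D,b]$, $a,b\in A$. The Hodge property means $\mathcal{C}\ell_D(A)'=\mathcal{C}\ell_D(A)^\circ$. *)

theory Defs
  imports "Jordan_Normal_Form.Matrix" Complex_Main
begin

text \<open>A vector (v,w) of H is encoded as a vector h in C^32 with
  h (8*i + 4*k + j) = (if k = 0 then v else w) (i,j), 0-based indices i,j<4, k<2.
  The matrix units e_ij below are 1-based as in the paper.  The basis used is
  orthonormal for the trace inner product, so operator adjoints are conjugate transposes.\<close>

definition idx :: "nat \<Rightarrow> nat \<Rightarrow> nat \<Rightarrow> nat" where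
  "idx i k j = 8 * i + 4 * k + j"

definition toH :: "complex mat \<Rightarrow> complex mat \<Rightarrow> complex vec" where
  "toH v w = vec 32 (\<lambda>a. if (a div 4) mod 2 = 0 then v $$ (a div 8, a mod 4)
                                               else w $$ (a div 8, a mod 4))"

definition munit :: "nat \<Rightarrow> nat \<Rightarrow> nat \<Rightarrow> complex mat" where
  "munit n i j = mat n n (\<lambda>(r, c). if r = i - 1 \<and> c = j - 1 then 1 else 0)"

text \<open>Identification of x (x) [a b; c d] (x) y with an operator on H:
  ((x (x) M (x) y) h)(i,k,j) = sum over p,l,q of x_ip M_kl y_jq h(p,l,q),
  i.e. exactly (x(av+bw)y^t, x(cv+dw)y^t).\<close>
definition tens3 :: "complex mat \<Rightarrow> complex mat \<Rightarrow> complex mat \<Rightarrow> complex mat" where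
  "tens3 x m y = mat 32 32 (\<lambda>(r, c).
      x $$ (r div 8, c div 8) * m $$ ((r div 4) mod 2, (c div 4) mod 2) * y $$ (r mod 4, c mod 4))"

definition adj :: "complex mat \<Rightarrow> complex mat" where
  "adj M = transpose_mat (map_mat cnj M)"

text \<open>The antilinear isometry J(v,w) = (w^*, v^*): the (i,k,j) entry of J h is the
  conjugate of the (j,1-k,i) entry of h.\<close>
definition Jmap :: "complex vec \<Rightarrow> complex vec" where
  "Jmap h = vec 32 (\<lambda>a. cnj (h $ idx (a mod 4) (1 - (a div 4) mod 2) (a div 8)))"

text \<open>Matrix of the complex-linear operator h \<mapsto> J (\<xi> (J^{-1} h)); note J^{-1} = J.\<close>
definition Jconj :: "complex mat \<Rightarrow> complex mat" where
  "Jconj \<xi> = mat 32 32 (\<lambda>(a, b). Jmap (\<xi> *\<^sub>v Jmap (unit_vec 32 b)) $ a)"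

definition opp :: "complex mat \<Rightarrow> complex mat" where
  "opp \<xi> = Jconj (adj \<xi>)"

definition End_H :: "complex mat set" where
  "End_H = carrier_mat 32 32"

definition commutant :: "complex mat set \<Rightarrow> complex mat set" where
  "commutant S = {\<xi> \<in> End_H. \<forall>\<eta>\<in>S. \<xi> * \<eta> = \<eta> * \<xi>}"

definition diag_ssq :: "complex \<Rightarrow> complex \<Rightarrow> complex mat \<Rightarrow> complex mat" where
  "diag_ssq a b q = mat 4 4 (\<lambda>(r, c).
     if r = 0 \<and> c = 0 then a else if r = 1 \<and> c = 1 then b
     else if 2 \<le> r \<and> 2 \<le> c then q $$ (r - 2, c - 2) else 0)"

definition diag_sm :: "complex \<Rightarrow> complex mat \<Rightarrow> complex mat" where
  "diag_sm a m = mat 4 4 (\<lambda>(r, c).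
     if r = 0 \<and> c = 0 then a else if 1 \<le> r \<and> 1 \<le> c then m $$ (r - 1, c - 1) else 0)"

definition mat2 :: "complex \<Rightarrow> complex \<Rightarrow> complex \<Rightarrow> complex \<Rightarrow> complex mat" where
  "mat2 a b c d = mat 2 2 (\<lambda>(r, s). if r = 0 then (if s = 0 then a else b)
                                      else (if s = 0 then c else d))"

definition quat :: "complex \<Rightarrow> complex \<Rightarrow> complex mat" where
  "quat z w = mat2 z w (- cnj w) (cnj z)"

definition algA :: "complex mat set" where
  "algA = {tens3 (diag_ssq l (cnj l) (quat z w)) (munit 2 1 1) (1\<^sub>m 4)
           + tens3 (diag_sm l m) (munit 2 2 2) (1\<^sub>m 4)
          | l z w m. m \<in> carrier_mat 3 3}"

inductive_set ClD :: "complex mat \<Rightarrow> complex mat set \<Rightarrow> complex mat set"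
  for D :: "complex mat" and A :: "complex mat set" where
  gen_A: "a \<in> A \<Longrightarrow> a \<in> ClD D A"
| gen_comm: "a \<in> A \<Longrightarrow> b \<in> A \<Longrightarrow> a * (D * b - b * D) \<in> ClD D A"
| add: "x \<in> ClD D A \<Longrightarrow> y \<in> ClD D A \<Longrightarrow> x + y \<in> ClD D A"
| mult: "x \<in> ClD D A \<Longrightarrow> y \<in> ClD D A \<Longrightarrow> x * y \<in> ClD D A"
| smult: "x \<in> ClD D A \<Longrightarrow> c \<cdot>\<^sub>m x \<in> ClD D A"
| star: "x \<in> ClD D A \<Longrightarrow> adj x \<in> ClD D A"

definition Hodge :: "complex mat \<Rightarrow> complex mat set \<Rightarrow> bool" where
  "Hodge D A \<longleftrightarrow> commutant (ClD D A) = opp ` ClD D A"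

definition Xmat :: "complex mat \<Rightarrow> complex mat" where
  "Xmat a = four_block_mat (0\<^sub>m 2 2) a (adj a) (0\<^sub>m 2 2)"

definition Ymat :: "complex \<Rightarrow> complex \<Rightarrow> complex \<Rightarrow> complex \<Rightarrow> complex \<Rightarrow> complex \<Rightarrow> complex
                    \<Rightarrow> complex mat" where
  "Ymat d12 d13 d14 d21 d22 d23 d24 = mat 4 4 (\<lambda>(r, c).
     if r = 0 then [0, d12, d13, d14] ! c
     else if r = 1 then [d21, d22, d23, d24] ! c else 0)"

definition D0 :: "complex mat \<Rightarrow> complex mat \<Rightarrow> complex mat \<Rightarrow> complex mat" where
  "D0 al be Y = tens3 (Xmat al) (munit 2 1 1) (munit 4 1 1)
              + tens3 (Xmat be) (munit 2 1 1) (1\<^sub>m 4 - munit 4 1 1)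
              + tens3 Y (munit 2 1 2) (munit 4 1 1)
              + tens3 (adj Y) (munit 2 2 1) (munit 4 1 1)"

definition DR :: "complex \<Rightarrow> complex mat" where
  "DR u = tens3 (munit 4 1 1) (u \<cdot>\<^sub>m munit 2 2 1 + cnj u \<cdot>\<^sub>m munit 2 1 2) (munit 4 1 1)"

definition Dirac :: "complex mat \<Rightarrow> complex mat \<Rightarrow> complex mat \<Rightarrow> complex \<Rightarrow> complex mat" where
  "Dirac al be Y u = D0 al be Y + Jconj (D0 al be Y) + DR u"

end

theory Submission
  imports Defs
begin

text \<open>
  Since \<open>D\<^sub>1\<close> and \<open>D\<^sub>R\<close> commute with \<open>A\<close>, only \<open>D\<^sub>0\<close> contributes to the Clifford algebra.  The
  operator \<open>D\<^sub>0\<close> acts as a weighted graph on the irreducible components of \<open>A\<close>: on the first column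
  (\<open>j = 0\<close>) the vectors \<open>\<alpha>\<^sub>1, \<alpha>\<^sub>2, \<delta>\<^sub>2, \<delta>\<^sub>1\<close> are the edges of a 4-cycle, and on the other columns
  \<open>\<beta>\<^sub>2\<close> is an edge joining two components.  Three edges of the 4-cycle are non-zero iff the cycle stays
  connected.  The Clifford algebra always lies in the algebra \<open>M\<^sub>7 \<oplus> \<complex> \<oplus> M\<^sub>3 \<oplus> M\<^sub>3\<close> acting with
  multiplicities 1, 7, 3, 3, and the opposite of that algebra is its commutant.  If the graph is
  connected and \<open>\<beta>\<^sub>2 \<noteq> 0\<close>, all matrix units are reached, so the Clifford algebra is the whole algebra
  and the Hodge property holds.  Otherwise the projection onto a union of components that no edge leaves
  commutes with the Clifford algebra but not with all matrix units, hence is not in the opposite algebra.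
\<close>

subsection \<open>Basis labels\<close>

definition tau :: "nat \<Rightarrow> nat" where
  "tau r = idx (r mod 4) (1 - (r div 4) mod 2) (r div 8)"

text \<open>A basis vector is indexed by \<open>4 * s + j\<close> with \<open>s = 2 * i + k\<close>, and \<open>tau\<close> is the index permutation
  underlying \<open>J\<close>.  Generically \<open>H\<close> is the direct sum of four isotypic components \<open>P \<otimes> Q\<close> of the Clifford
  algebra: \<open>plab\<close> names the basis vector of the irreducible factor \<open>P\<close>, \<open>qlab\<close> that of the multiplicity
  space \<open>Q\<close>, and \<open>J\<close> exchanges the two roles.\<close>

definition plab :: "nat \<Rightarrow> nat" where
  "plab r = (if r mod 4 = 0 then r div 4 else if r div 4 < 2 then 1 else 8 + r div 4)"

definition qlab :: "nat \<Rightarrow> nat" where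
  "qlab r = plab (tau r)"

lemma nat_less_32_cases:
  assumes "r < (32::nat)"
  obtains s j where "r = 4 * s + j" "s < 8" "j < 4"
  using assms that[of "r div 4" "r mod 4"] by auto

lemma less_8_cases: "s < (8::nat) \<Longrightarrow> s = 0 \<or> s = 1 \<or> s = 2 \<or> s = 3 \<or> s = 4 \<or> s = 5 \<or> s = 6 \<or> s = 7"
  by linarith

lemma tau_less [simp]: "r < 32 \<Longrightarrow> tau r < 32"
  unfolding tau_def idx_def by simp

lemma coord_div:
  fixes s j :: nat
  assumes "j < 4"
  shows "(4 * s + j) div 8 = s div 2" "(4 * s + j) div 4 = s" "(4 * s + j) mod 4 = j"
  using assms div_mult2_eq[of "4 * s + j" 4 2] by simp_all

text \<open>The digit \<open>1 - s mod 2\<close> is 0 or 1 and is added to an even number, so the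
  sum determines both parts. The large values of \<open>qlab\<close> have this form.\<close>

lemma parity_coord_inj:
  fixes s t j k :: nat
  assumes "8 + 2 * j + (1 - s mod 2) = 8 + 2 * k + (1 - t mod 2)"
  shows "j = k" "s mod 2 = t mod 2"
proof -
  have "j = k \<and> s mod 2 = t mod 2"
  proof (cases "even s \<longleftrightarrow> even t")
    case True
    then have "s mod 2 = t mod 2" by (simp add: mod2_eq_if)
    then show ?thesis using assms by simp
  next
    case False
    then have "(8 + 2 * j + (1 - s mod 2)) mod 2 \<noteq> (8 + 2 * k + (1 - t mod 2)) mod 2"
      by (cases "even s"; simp add: mod2_eq_if)
    then show ?thesis using assms by simp
  qed
  then show "j = k" "s mod 2 = t mod 2" by simp_all
qed

lemma tau_coord: "j < 4 \<Longrightarrow> tau (4 * s + j) = 4 * (2 * j + (1 - s mod 2)) + s div 2"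
  by (simp add: tau_def idx_def coord_div)

text \<open>\<open>J\<close> is an involution: swapping the two matrix coordinates and flipping the
  summand twice restores the index.\<close>

lemma tau_tau [simp]:
  assumes "r < 32"
  shows "tau (tau r) = r"
proof -
  obtain s j where r: "r = 4 * s + j" "s < 8" "j < 4"
    using nat_less_32_cases[OF assms] .
  have "s div 2 < 4"
    using r(2) by linarith
  then have "tau (tau r) = 4 * (2 * (s div 2) + (1 - (2 * j + (1 - s mod 2)) mod 2))
      + (2 * j + (1 - s mod 2)) div 2"
    by (simp only: r(1) tau_coord[OF r(3)] tau_coord[of "s div 2"])
  moreover have "(2 * j + (1 - s mod 2)) mod 2 = 1 - s mod 2" "(2 * j + (1 - s mod 2)) div 2 = j"
    by (cases "even s"; simp add: mod2_eq_if)+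
  moreover have "2 * (s div 2) + (1 - (1 - s mod 2)) = s"
    by (cases "even s") (auto simp: mod2_eq_if elim: evenE oddE)
  ultimately show ?thesis
    by (simp only: r(1))
qed

lemma tau_eq_iff: "a < 32 \<Longrightarrow> b < 32 \<Longrightarrow> tau a = b \<longleftrightarrow> a = tau b"
  using tau_tau by metis

lemma qlab_tau [simp]: "r < 32 \<Longrightarrow> qlab (tau r) = plab r"
  by (simp add: qlab_def)

lemma plab_tau [simp]: "plab (tau r) = qlab r"
  by (simp add: qlab_def)

lemma plab_coord: "j < 4 \<Longrightarrow> plab (4 * s + j) = (if j = 0 then s else if s < 2 then 1 else 8 + s)"
  by (simp add: plab_def)

lemma qlab_coord:
  assumes "s < 8" "j < 4"
  shows "qlab (4 * s + j) =
    (if s < 2 then 2 * j + (1 - s) else if j = 0 then 1 else 8 + 2 * j + (1 - s mod 2))"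
proof -
  have "tau (4 * s + j) = 4 * (2 * j + (1 - s mod 2)) + s div 2"
    using assms(2) by (rule tau_coord)
  moreover have "s div 2 < 4"
    using assms by linarith
  ultimately have "qlab (4 * s + j) = (if s div 2 = 0 then 2 * j + (1 - s mod 2)
      else if 2 * j + (1 - s mod 2) < 2 then 1 else 8 + (2 * j + (1 - s mod 2)))"
    by (simp only: qlab_def plab_coord)
  moreover have "s = 0 \<or> s = 1 \<or> \<not> s < 2" by linarith
  ultimately show ?thesis
    by auto
qed

text \<open>The cases follow the isotypic components. Cases 1 and 4 give the seven vectors of
  multiplicity one, cases 2 and 3 the seven copies of the one-dimensional factor labelled 1, and
  case 5 both three-dimensional factors of multiplicity three, told apart by the parity of
  \<open>s\<close>.\<close>

lemma label_cases:
  assumes "r < 32"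
  obtains "r = 0" "plab r = 0" "qlab r = 1"
  | "r = 1 \<or> r = 2 \<or> r = 3" "plab r = 1" "qlab r = 2 * r + 1"
  | "r = 4 \<or> r = 5 \<or> r = 6 \<or> r = 7" "plab r = 1" "qlab r = 2 * (r - 4)"
  | s where "r = 4 * s" "2 \<le> s" "s < 8" "plab r = s" "qlab r = 1"
  | s j where "r = 4 * s + j" "2 \<le> s" "s < 8" "0 < j" "j < 4" "plab r = 8 + s"
      "qlab r = 8 + 2 * j + (1 - s mod 2)"
proof -
  obtain s j where r: "r = 4 * s + j" "s < 8" "j < 4"
    using nat_less_32_cases[OF assms] .
  consider "s = 0" "j = 0" | "s = 0" "0 < j" | "s = 1" | "2 \<le> s" "j = 0" | "2 \<le> s" "0 < j"
    by linarith
  then show thesis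
  proof cases
    case 1
    then show thesis using r that(1) plab_coord[of j s] qlab_coord[of s j] by simp
  next
    case 2
    moreover have "j = 1 \<or> j = 2 \<or> j = 3" using 2 r by linarith
    ultimately show thesis using r that(2) plab_coord[of j s] qlab_coord[of s j] by simp
  next
    case 3
    moreover have "j = 0 \<or> j = 1 \<or> j = 2 \<or> j = 3" using r by linarith
    ultimately show thesis using r that(3) plab_coord[of j s] qlab_coord[of s j] by auto
  next
    case 4
    then show thesis using r that(4)[of s] plab_coord[of j s] qlab_coord[of s j] by simp
  next
    case 5
    then show thesis using r that(5)[of s j] plab_coord[of j s] qlab_coord[of s j] by simp
  qed
qed

lemma plab_ge_10:
  assumes "r < 32" "plab r \<ge> 10"
  obtains s j where "r = 4 * s + j" "2 \<le> s" "s < 8" "0 < j" "j < 4" "plab r = 8 + s"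
      "qlab r = 8 + 2 * j + (1 - s mod 2)"
  by (rule label_cases[OF assms(1)]) (use assms(2) in auto)

lemma plab_less_8:
  assumes "r < 32" "plab r < 10"
  shows "plab r = 1 \<and> (r = 1 \<and> qlab r = 3 \<or> r = 2 \<and> qlab r = 5 \<or> r = 3 \<and> qlab r = 7 \<or> r = 4 \<and> qlab r = 0
      \<or> r = 5 \<and> qlab r = 2 \<or> r = 6 \<and> qlab r = 4 \<or> r = 7 \<and> qlab r = 6)
    \<or> plab r \<noteq> 1 \<and> plab r < 8 \<and> r = 4 * plab r \<and> qlab r = 1"
  by (rule label_cases[OF assms(1)]) (use assms(2) in auto)

lemma qlab_ge_10_iff:
  assumes "r < 32"
  shows "10 \<le> qlab r \<longleftrightarrow> 10 \<le> plab r"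
  by (rule label_cases[OF assms]) auto

lemma plab_small:
  assumes "r < 32" "\<not> 10 \<le> plab r"
  shows "plab r < 8" "plab r = 1 \<longleftrightarrow> qlab r \<noteq> 1"
  by (rule label_cases[OF assms(1)]; use assms(2) in auto)+

text \<open>\<open>(plab, qlab)\<close> thus works as a pair of coordinates: basis vectors of H are
  tensors of a basis vector of P with one of Q.\<close>

lemma label_inj:
  assumes "r < 32" "c < 32" "plab r = plab c" "qlab r = qlab c"
  shows "r = c"
proof (cases "10 \<le> plab r")
  case True
  obtain s j where r: "r = 4 * s + j" "plab r = 8 + s" "qlab r = 8 + 2 * j + (1 - s mod 2)"
    using plab_ge_10[OF assms(1) True] by metis
  obtain t k where c: "c = 4 * t + k" "plab c = 8 + t" "qlab c = 8 + 2 * k + (1 - t mod 2)"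
    using plab_ge_10[OF assms(2)] True assms(3) by metis
  show ?thesis using r c assms(3,4) by simp
next
  case False
  then show ?thesis
    using plab_less_8[of r] plab_less_8[of c] assms by auto
qed

text \<open>The attained label pairs form a disjoint union of full rectangles, one for each
  component P \<otimes> Q. Three corners of a rectangle therefore force the fourth.\<close>

lemma label_rectangle:
  assumes "r < 32" "x < 32" "c < 32" "qlab r = qlab x" "plab x = plab c"
  obtains y where "y < 32" "plab y = plab r" "qlab y = qlab c"
proof (cases "10 \<le> plab r")
  case True
  obtain s j where r: "r = 4 * s + j" "2 \<le> s" "s < 8" "plab r = 8 + s"
    "qlab r = 8 + 2 * j + (1 - s mod 2)"
    using plab_ge_10[OF assms(1) True] by metis
  have x10: "10 \<le> plab x"
    using qlab_ge_10_iff assms True by metis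
  obtain t k where x: "plab x = 8 + t" "qlab x = 8 + 2 * k + (1 - t mod 2)"
    using plab_ge_10[OF assms(2) x10] by metis
  obtain u l where c: "c = 4 * u + l" "0 < l" "l < 4" "plab c = 8 + u"
    "qlab c = 8 + 2 * l + (1 - u mod 2)"
    using plab_ge_10[OF assms(3)] x10 assms(5) by metis
  have "8 + 2 * j + (1 - s mod 2) = 8 + 2 * k + (1 - t mod 2)"
    using r(5) x(2) assms(4) by (simp only:)
  then have "s mod 2 = t mod 2"
    by (rule parity_coord_inj)
  then have "1 - s mod 2 = 1 - t mod 2"
    by (simp only:)
  moreover have "u = t"
    using x c assms(5) by simp
  moreover have "qlab (4 * s + l) = 8 + 2 * l + (1 - s mod 2)"
    using r c by (simp add: qlab_coord)
  ultimately have "qlab (4 * s + l) = qlab c"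
    by (simp only: c(5))
  then show ?thesis
    using that[of "4 * s + l"] r c by (simp add: plab_coord)
next
  case False
  have "\<not> 10 \<le> plab x"
    using False assms(4) qlab_ge_10_iff[OF assms(1)] qlab_ge_10_iff[OF assms(2)] by simp
  \<comment> \<open>Below 10 exactly one of the two labels of a vector equals 1, so each rectangle
    has only one row or one column and the fourth corner is \<open>r\<close> or \<open>c\<close>
    itself.\<close>
  then have "qlab r = qlab c \<or> plab r = plab c"
    using plab_small[OF assms(1)] plab_small[OF assms(2)] plab_small[OF assms(3)] False assms(4,5) by auto
  then show ?thesis
    using that[of r] that[of c] assms(1,3) by auto
qed

subsection \<open>Block matrices\<close>

text \<open>The operator that acts as \<open>f\<close> on P and as the identity on the multiplicity
  space Q; entries between different components are discarded.\<close>

definition blk :: "(nat \<Rightarrow> nat \<Rightarrow> complex) \<Rightarrow> complex mat" where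
  "blk f = mat 32 32 (\<lambda>(r, c). if qlab r = qlab c then f (plab r) (plab c) else 0)"

text \<open>The matrix unit of P at position \<open>(a, b)\<close>, amplified by the identity of
  Q.\<close>

definition lunit :: "nat \<Rightarrow> nat \<Rightarrow> complex mat" where
  "lunit a b = blk (\<lambda>x y. if x = a \<and> y = b then 1 else 0)"

lemma blk_carrier [simp]: "blk f \<in> carrier_mat 32 32"
  by (simp add: blk_def)

lemma lunit_carrier [simp]: "lunit a b \<in> carrier_mat 32 32"
  by (simp add: lunit_def)

lemma blk_dim [simp]: "dim_row (blk f) = 32" "dim_col (blk f) = 32"
  by (simp_all add: blk_def)

lemma blk_index:
  "r < 32 \<Longrightarrow> c < 32 \<Longrightarrow> blk f $$ (r, c) = (if qlab r = qlab c then f (plab r) (plab c) else 0)"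
  by (simp add: blk_def)

lemma lunit_index:
  "r < 32 \<Longrightarrow> c < 32 \<Longrightarrow>
    lunit a b $$ (r, c) = (if qlab r = qlab c \<and> plab r = a \<and> plab c = b then 1 else 0)"
  by (simp add: lunit_def blk_index)

section \<open>Adjoints, opposites and the commutant of the opposite matrix units\<close>

lemma mult_index_32:
  assumes "A \<in> carrier_mat 32 32" "B \<in> carrier_mat 32 32" "r < 32" "c < 32"
  shows "(A * B) $$ (r, c) = (\<Sum>x<32. A $$ (r, x) * B $$ (x, c))"
  using assms by (auto simp: scalar_prod_def atLeast0LessThan intro!: sum.cong)

lemma opp_carrier [simp]: "opp \<xi> \<in> carrier_mat 32 32"
  by (simp add: opp_def Jconj_def)

lemma opp_dim [simp]: "dim_row (opp \<xi>) = 32" "dim_col (opp \<xi>) = 32"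
  by (simp_all add: opp_def Jconj_def)

lemma adj_dim [simp]: "dim_row (adj \<xi>) = dim_col \<xi>" "dim_col (adj \<xi>) = dim_row \<xi>"
  by (simp_all add: adj_def)

lemma adj_carrier [simp]: "\<xi> \<in> carrier_mat n m \<Longrightarrow> adj \<xi> \<in> carrier_mat m n"
  by (simp add: adj_def)

lemma adj_index: "\<xi> \<in> carrier_mat n m \<Longrightarrow> r < m \<Longrightarrow> c < n \<Longrightarrow> adj \<xi> $$ (r, c) = cnj (\<xi> $$ (c, r))"
  by (simp add: adj_def)

lemma Jconj_index:
  assumes "\<xi> \<in> carrier_mat 32 32" "r < 32" "c < 32"
  shows "Jconj \<xi> $$ (r, c) = cnj (\<xi> $$ (tau r, tau c))"
proof -
  have Jmap: "Jmap h = vec 32 (\<lambda>a. cnj (h $ tau a))" for h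
    by (simp only: Jmap_def tau_def)
  have "Jmap (unit_vec 32 c) = unit_vec 32 (tau c)"
    using assms by (intro eq_vecI) (auto simp: Jmap tau_eq_iff)
  then show ?thesis
    using assms by (simp add: Jconj_def) (simp add: Jmap)
qed

lemma opp_index:
  assumes "\<xi> \<in> carrier_mat 32 32" "r < 32" "c < 32"
  shows "opp \<xi> $$ (r, c) = \<xi> $$ (tau c, tau r)"
  using assms by (simp add: opp_def Jconj_index adj_index)

lemma opp_opp [simp]: "\<xi> \<in> carrier_mat 32 32 \<Longrightarrow> opp (opp \<xi>) = \<xi>"
  by (rule eq_matI) (auto simp: opp_index)

lemma opp_mult:
  assumes "A \<in> carrier_mat 32 32" "B \<in> carrier_mat 32 32"
  shows "opp (A * B) = opp B * opp A"
proof (rule eq_matI)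
  fix r c assume "r < dim_row (opp B * opp A)" "c < dim_col (opp B * opp A)"
  then have rc: "r < 32" "c < 32"
    by simp_all
  have "opp (A * B) $$ (r, c) = (\<Sum>x<32. A $$ (tau c, x) * B $$ (x, tau r))"
    using assms rc by (simp add: opp_index mult_index_32 del: index_mult_mat(1))
  also have "\<dots> = (\<Sum>x<32. A $$ (tau c, tau x) * B $$ (tau x, tau r))"
    by (rule sum.reindex_bij_witness[of _ tau tau]) auto
  also have "\<dots> = (opp B * opp A) $$ (r, c)"
    using assms rc by (simp add: opp_index mult_index_32 mult.commute del: index_mult_mat(1))
  finally show "opp (A * B) $$ (r, c) = (opp B * opp A) $$ (r, c)" .
qed simp_all

lemma opp_adj:
  assumes "\<xi> \<in> carrier_mat 32 32"
  shows "opp (adj \<xi>) = adj (opp \<xi>)"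
  using assms by (intro eq_matI) (auto simp: opp_index adj_index[of _ 32 32])

lemma adj_adj [simp]: "\<xi> \<in> carrier_mat n m \<Longrightarrow> adj (adj \<xi>) = \<xi>"
  by (rule eq_matI) (auto simp: adj_def)

lemma adj_mult:
  assumes "A \<in> carrier_mat 32 32" "B \<in> carrier_mat 32 32"
  shows "adj (A * B) = adj B * adj A"
proof (rule eq_matI)
  fix r c assume "r < dim_row (adj B * adj A)" "c < dim_col (adj B * adj A)"
  then have rc: "r < 32" "c < 32"
    using assms by (simp_all add: adj_def)
  then show "adj (A * B) $$ (r, c) = (adj B * adj A) $$ (r, c)"
    using assms by (simp add: adj_index[of _ 32 32] mult_index_32 mult.commute del: index_mult_mat(1))
qed (use assms in \<open>auto simp: adj_def\<close>)

lemma commutant_opp: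
  assumes "S \<subseteq> carrier_mat 32 32"
  shows "commutant (opp ` S) = opp ` commutant S"
proof -
  have *: "opp \<xi> \<in> commutant (opp ` T)" if T: "T \<subseteq> carrier_mat 32 32" and \<xi>: "\<xi> \<in> commutant T" for T \<xi>
  proof -
    have "opp \<xi> * opp \<eta> = opp \<eta> * opp \<xi>" if "\<eta> \<in> T" for \<eta>
    proof -
      have "\<eta> \<in> carrier_mat 32 32" "\<xi> \<in> carrier_mat 32 32" "\<xi> * \<eta> = \<eta> * \<xi>"
        using that T \<xi> by (auto simp: commutant_def End_H_def)
      then show ?thesis by (metis opp_mult)
    qed
    then show ?thesis by (simp add: commutant_def End_H_def)
  qed
  have "opp ` opp ` S = S"
    unfolding image_image using assms by (auto simp: image_iff subset_iff)
  then have "opp \<xi> \<in> commutant S" if "\<xi> \<in> commutant (opp ` S)" for \<xi>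
    using *[of "opp ` S" \<xi>] that by (simp add: image_subset_iff)
  moreover have "\<xi> = opp (opp \<xi>)" if "\<xi> \<in> commutant (opp ` S)" for \<xi>
    using that by (simp add: commutant_def End_H_def)
  ultimately show ?thesis
    using *[OF assms] by blast
qed

text \<open>Since \<open>J\<close> exchanges P and Q, the opposite of a matrix unit on P is a
  transposed matrix unit on Q.\<close>

lemma opp_lunit_index:
  assumes "r < 32" "c < 32"
  shows "opp (lunit a b) $$ (r, c) = (if plab r = plab c \<and> qlab r = b \<and> qlab c = a then 1 else 0)"
  using assms by (auto simp: opp_index lunit_index)

lemma sum_at_most_one:
  fixes f :: "nat \<Rightarrow> complex"
  assumes "x < n" "\<And>y. y < n \<Longrightarrow> P y \<Longrightarrow> y = x" "P x"
  shows "(\<Sum>y<n. if P y then f y else 0) = f x"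
proof -
  have "P y \<longleftrightarrow> y = x" if "y < n" for y
    using assms that by blast
  then have "(\<Sum>y<n. if P y then f y else 0) = (\<Sum>y<n. if y = x then f y else 0)"
    by (intro sum.cong) auto
  then show ?thesis using assms(1) by simp
qed

lemma mult_opp_lunit_index:
  assumes "\<xi> \<in> carrier_mat 32 32" "r < 32" "c < 32"
  shows "(\<xi> * opp (lunit a b)) $$ (r, c) =
    (\<Sum>x<32. if plab x = plab c \<and> qlab x = b \<and> qlab c = a then \<xi> $$ (r, x) else 0)"
  unfolding mult_index_32[OF assms(1) opp_carrier assms(2,3)]
  by (rule sum.cong[OF refl]) (simp add: opp_lunit_index assms(3))

lemma opp_lunit_mult_index:
  assumes "\<xi> \<in> carrier_mat 32 32" "r < 32" "c < 32"
  shows "(opp (lunit a b) * \<xi>) $$ (r, c) =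
    (\<Sum>x<32. if plab x = plab r \<and> qlab x = a \<and> qlab r = b then \<xi> $$ (x, c) else 0)"
  unfolding mult_index_32[OF opp_carrier assms(1) assms(2,3)]
  by (rule sum.cong[OF refl]) (auto simp add: opp_lunit_index assms(2))

text \<open>The opposite units generate all operators on the multiplicity spaces, so whatever
  commutes with them acts on the factors P alone.\<close>

lemma commutant_opp_lunit: "commutant (opp ` range (\<lambda>(a, b). lunit a b)) = range blk"
proof (intro subset_antisym subsetI)
  fix \<xi> assume "\<xi> \<in> range blk"
  then obtain f where \<xi>: "\<xi> = blk f" by auto
  have "blk f * opp (lunit a b) = opp (lunit a b) * blk f" for a b
  proof (rule eq_matI)
    fix r c assume "r < dim_row (opp (lunit a b) * blk f)" "c < dim_col (opp (lunit a b) * blk f)"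
    then have rc: "r < 32" "c < 32"
      by simp_all
    let ?L = "\<Sum>x<32. if plab x = plab c \<and> qlab x = b \<and> qlab c = a then blk f $$ (r, x) else 0"
    let ?R = "\<Sum>y<32. if plab y = plab r \<and> qlab y = a \<and> qlab r = b then blk f $$ (y, c) else 0"
    have "?L = ?R"
    proof (cases "qlab r = b \<and> qlab c = a")
      case False
      have "?L = 0" "?R = 0"
        using False rc by (auto simp: blk_index intro!: sum.neutral)
      then show ?thesis by simp
    next
      case True
      show ?thesis
      proof (cases "\<exists>x<32. plab x = plab c \<and> qlab x = b")
        \<comment> \<open>Each sum has a single surviving term. The two terms sit at opposite
          corners of a label rectangle, and both entries of \<open>blk f\<close> equal
          \<open>f (plab r) (plab c)\<close>.\<close>
        case xex: True
        then obtain x where x: "x < 32" "plab x = plab c" "qlab x = b" by auto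
        obtain y where y: "y < 32" "plab y = plab r" "qlab y = a"
          using label_rectangle[of r x c] rc x True by metis
        have "?L = blk f $$ (r, x)"
          by (subst sum_at_most_one[where x = x]) (use x True in \<open>auto intro: label_inj\<close>)
        moreover have "?R = blk f $$ (y, c)"
          by (subst sum_at_most_one[where x = y]) (use y True in \<open>auto intro: label_inj\<close>)
        ultimately show ?thesis
          using rc x y True by (simp add: blk_index)
      next
        case xne: False
        then have "\<not> (\<exists>y<32. plab y = plab r \<and> qlab y = a)"
          using label_rectangle[of c _ r] rc True by metis
        then have "?L = 0" "?R = 0"
          using xne by (auto intro!: sum.neutral)
        then show ?thesis by simp
      qed
    qed
    then show "(blk f * opp (lunit a b)) $$ (r, c) = (opp (lunit a b) * blk f) $$ (r, c)"
      by (simp only: mult_opp_lunit_index[OF blk_carrier rc] opp_lunit_mult_index[OF blk_carrier rc])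
  qed simp_all
  then show "\<xi> \<in> commutant (opp ` range (\<lambda>(a, b). lunit a b))"
    by (auto simp: commutant_def End_H_def \<xi>)
next
  fix \<xi> assume "\<xi> \<in> commutant (opp ` range (\<lambda>(a, b). lunit a b))"
  then have \<xi>: "\<xi> \<in> carrier_mat 32 32" and comm: "\<And>a b. \<xi> * opp (lunit a b) = opp (lunit a b) * \<xi>"
    by (auto simp: commutant_def End_H_def)
  have eq: "(\<Sum>x<32. if plab x = plab c \<and> qlab x = b \<and> qlab c = a then \<xi> $$ (r, x) else 0) =
      (\<Sum>x<32. if plab x = plab r \<and> qlab x = a \<and> qlab r = b then \<xi> $$ (x, c) else 0)"
    if "r < 32" "c < 32" for a b r c
    using arg_cong[OF comm[of a b], of "\<lambda>m. m $$ (r, c)"]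
    unfolding mult_opp_lunit_index[OF \<xi> that] opp_lunit_mult_index[OF \<xi> that] .
  \<comment> \<open>Commuting with the projection onto one multiplicity label removes entries
    between different labels.\<close>
  have diag: "\<xi> $$ (r, c) = 0" if "r < 32" "c < 32" "qlab r \<noteq> qlab c" for r c
  proof -
    have "(\<Sum>x<32. if plab x = plab c \<and> qlab x = qlab c \<and> qlab c = qlab c then \<xi> $$ (r, x) else 0) = \<xi> $$ (r, c)"
      by (rule sum_at_most_one) (use that in \<open>auto intro: label_inj\<close>)
    with eq[of r c "qlab c" "qlab c"] that show ?thesis by simp
  qed
  \<comment> \<open>Commuting with the operator that moves one copy of P to another shows that all
    copies carry the same matrix.\<close>
  have dep: "\<xi> $$ (r, c) = \<xi> $$ (r', c')"
    if "r < 32" "c < 32" "r' < 32" "c' < 32" "qlab r = qlab c" "qlab r' = qlab c'"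
      "plab r = plab r'" "plab c = plab c'" for r c r' c'
  proof -
    have "(\<Sum>x<32. if plab x = plab c' \<and> qlab x = qlab c \<and> qlab c' = qlab c' then \<xi> $$ (r, x) else 0)
        = \<xi> $$ (r, c)"
      by (rule sum_at_most_one) (use that in \<open>auto intro: label_inj\<close>)
    moreover have "(\<Sum>x<32. if plab x = plab r \<and> qlab x = qlab c' \<and> qlab r = qlab c then \<xi> $$ (x, c') else 0)
        = \<xi> $$ (r', c')"
      by (rule sum_at_most_one) (use that in \<open>auto intro: label_inj\<close>)
    ultimately show ?thesis
      using eq[of r c' "qlab c" "qlab c'"] that by simp
  qed
  \<comment> \<open>The matrix on P is read off at any index pair carrying the labels; by
    \<open>dep\<close> the choice does not matter.\<close>
  define P where "P a b rc \<longleftrightarrow> fst rc < 32 \<and> snd rc < 32 \<and> qlab (fst rc) = qlab (snd rc) \<and>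
    plab (fst rc) = a \<and> plab (snd rc) = b" for a b and rc :: "nat \<times> nat"
  have "\<xi> = blk (\<lambda>a b. \<xi> $$ (SOME rc. P a b rc))"
  proof (rule eq_matI)
    fix r c assume "r < dim_row (blk (\<lambda>a b. \<xi> $$ (SOME rc. P a b rc)))"
      "c < dim_col (blk (\<lambda>a b. \<xi> $$ (SOME rc. P a b rc)))"
    then have rc: "r < 32" "c < 32" by (simp_all add: blk_def)
    show "\<xi> $$ (r, c) = blk (\<lambda>a b. \<xi> $$ (SOME rc. P a b rc)) $$ (r, c)"
    proof (cases "qlab r = qlab c")
      case True
      define z where "z = (SOME rc. P (plab r) (plab c) rc)"
      have "P (plab r) (plab c) z"
        unfolding z_def by (rule someI[of _ "(r, c)"]) (use rc True in \<open>simp add: P_def\<close>)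
      then have "\<xi> $$ (r, c) = \<xi> $$ (fst z, snd z)"
        using rc True by (intro dep) (auto simp: P_def)
      then show ?thesis using True rc by (simp add: blk_index z_def)
    qed (use rc diag in \<open>simp add: blk_index\<close>)
  qed (use \<xi> in \<open>auto simp: blk_def\<close>)
  then show "\<xi> \<in> range blk" by blast
qed

text \<open>The labels \<open>8\<close> and \<open>9\<close> are not attained; this is why \<open>a \<in> lclass a\<close> occurs as a premise below.\<close>

definition lclass :: "nat \<Rightarrow> nat set" where
  "lclass a = (if a = 1 then {1} else if a < 8 then {0,2,3,4,5,6,7}
     else if even a then {10,12,14} else {11,13,15})"

lemma finite_lclass [simp]: "finite (lclass a)"
  by (simp add: lclass_def)

lemma plab_less_16: "r < 32 \<Longrightarrow> plab r < 16"
  by (auto simp: plab_def)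

text \<open>Every multiplicity label sees a whole basis of its factor P. Sums over vectors with a
  fixed \<open>qlab\<close> thereby turn into sums over a class of labels.\<close>

lemma plab_image_lclass:
  assumes "r < 32"
  shows "plab ` {x. x < 32 \<and> qlab x = qlab r} = lclass (plab r)"
proof (cases "10 \<le> plab r")
  case True
  obtain s j where r: "r = 4 * s + j" "2 \<le> s" "s < 8" "0 < j" "j < 4" "plab r = 8 + s"
    "qlab r = 8 + 2 * j + (1 - s mod 2)"
    by (rule plab_ge_10[OF assms True])
  have cl: "a \<in> lclass (plab r) \<longleftrightarrow> (\<exists>t. a = 8 + t \<and> 2 \<le> t \<and> t < 8 \<and> t mod 2 = s mod 2)" for a
  proof
    assume "a \<in> lclass (plab r)"
    then have "a \<in> (if even s then {10, 12, 14} else {11, 13, 15})"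
      using r by (simp add: lclass_def)
    then have "2 \<le> a - 8 \<and> a - 8 < 8 \<and> (a - 8) mod 2 = s mod 2 \<and> a = 8 + (a - 8)"
      by (auto simp: mod2_eq_if split: if_splits)
    then show "\<exists>t. a = 8 + t \<and> 2 \<le> t \<and> t < 8 \<and> t mod 2 = s mod 2" by blast
  next
    assume "\<exists>t. a = 8 + t \<and> 2 \<le> t \<and> t < 8 \<and> t mod 2 = s mod 2"
    then obtain t where t: "a = 8 + t" "2 \<le> t" "t < 8" "t mod 2 = s mod 2" by blast
    have "t = 2 \<or> t = 3 \<or> t = 4 \<or> t = 5 \<or> t = 6 \<or> t = 7" using t by linarith
    then show "a \<in> lclass (plab r)"
      using r t by (elim disjE) (simp_all add: lclass_def mod2_eq_if split: if_splits)
  qed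
  have "plab x \<in> lclass (plab r)" if x: "x < 32" "qlab x = qlab r" for x
  proof -
    have "10 \<le> plab x"
      using qlab_ge_10_iff[OF assms] qlab_ge_10_iff[OF x(1)] x True by simp
    then obtain t k where t: "x = 4 * t + k" "2 \<le> t" "t < 8" "0 < k" "k < 4" "plab x = 8 + t"
        "qlab x = 8 + 2 * k + (1 - t mod 2)"
      by (rule plab_ge_10[OF x(1)])
    have "8 + 2 * k + (1 - t mod 2) = 8 + 2 * j + (1 - s mod 2)"
      using t(7) r(7) x(2) by (simp only:)
    then have "t mod 2 = s mod 2"
      by (rule parity_coord_inj)
    then show ?thesis unfolding cl using t(2,3,6) by (intro exI[of _ t]) simp
  qed
  moreover have "a \<in> plab ` {x. x < 32 \<and> qlab x = qlab r}" if a: "a \<in> lclass (plab r)" for a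
  proof -
    obtain t where t: "a = 8 + t" "2 \<le> t" "t < 8" "t mod 2 = s mod 2"
      using a unfolding cl by blast
    then show ?thesis
      using r by (intro image_eqI[of _ _ "4 * t + j"]) (simp_all add: plab_coord qlab_coord)
  qed
  ultimately show ?thesis by blast
next
  case False
  show ?thesis
  proof (cases "plab r = 1")
    case True
    have "x = r" if x: "x < 32" "qlab x = qlab r" for x
    proof -
      have "\<not> 10 \<le> plab x"
        using False x qlab_ge_10_iff[OF assms] qlab_ge_10_iff[OF x(1)] by simp
      then have "plab x = plab r"
        using plab_small(2)[OF assms False] plab_small(2)[of x] x True by simp
      then show ?thesis by (rule label_inj[OF x(1) assms _ x(2)])
    qed
    then have "{x. x < 32 \<and> qlab x = qlab r} = {r}"
      using assms by auto
    then show ?thesis using True by (simp add: lclass_def)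
  next
    case p1: False
    then have q: "qlab r = 1" and p: "plab r < 8"
      using plab_small[OF assms False] by auto
    have label: "plab x \<in> {0,2,3,4,5,6,7}" if x: "x < 32" "qlab x = 1" for x
    proof -
      have "\<not> 10 \<le> plab x" using x qlab_ge_10_iff[OF x(1)] by simp
      then have "plab x \<noteq> 1" "plab x < 8"
        using plab_small[of x] x by auto
      then show ?thesis by auto
    qed
    have attained: "a \<in> plab ` {x. x < 32 \<and> qlab x = 1}" if "a \<in> {0,2,3,4,5,6,7}" for a
      using that plab_coord[of 0 a] qlab_coord[of a 0]
      by (intro image_eqI[of _ _ "4 * a"]) auto
    have "plab ` {x. x < 32 \<and> qlab x = 1} = {0,2,3,4,5,6,7}"
    proof (intro subset_antisym subsetI)
      fix a assume "a \<in> plab ` {x. x < 32 \<and> qlab x = 1}"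
      then obtain x where "a = plab x" "x < 32" "qlab x = 1" by (elim imageE CollectE conjE)
      then show "a \<in> {0,2,3,4,5,6,7}" using label by simp
    qed (rule attained)
    then show ?thesis
      using q p p1 by (simp add: lclass_def)
  qed
qed

lemma plab_in_lclass: "r < 32 \<Longrightarrow> c < 32 \<Longrightarrow> qlab r = qlab c \<Longrightarrow> plab c \<in> lclass (plab r)"
  by (subst plab_image_lclass[symmetric]) auto

text \<open>Only attained labels and pairs inside one class reach an entry of the matrix.\<close>

lemma blk_cong:
  assumes "\<And>a b. a < 16 \<Longrightarrow> b < 16 \<Longrightarrow> a \<in> lclass a \<Longrightarrow> b \<in> lclass a \<Longrightarrow> f a b = g a b"
  shows "blk f = blk g"
  by (rule eq_matI) (auto simp: blk_index intro!: assms plab_less_16 plab_in_lclass)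

lemma blk_add: "blk f + blk g = blk (\<lambda>a b. f a b + g a b)"
  by (rule eq_matI) (auto simp: blk_index)

lemma blk_diff: "blk f - blk g = blk (\<lambda>a b. f a b - g a b)"
  by (rule eq_matI) (auto simp: blk_index)

lemma blk_smult: "k \<cdot>\<^sub>m blk f = blk (\<lambda>a b. k * f a b)"
  by (rule eq_matI) (auto simp: blk_index)

lemma adj_blk: "adj (blk f) = blk (\<lambda>a b. cnj (f b a))"
  by (rule eq_matI) (auto simp: blk_index adj_index[of _ 32 32])

lemma adj_lunit: "adj (lunit a b) = lunit b a"
  unfolding lunit_def adj_blk by (rule arg_cong[of _ _ blk]) (auto simp: fun_eq_iff)

text \<open>The intermediate index must share its \<open>qlab\<close> with the row, and on such
  indices \<open>plab\<close> is injective with the class as its image.\<close>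

lemma blk_mult: "blk f * blk g = blk (\<lambda>a b. \<Sum>l\<in>lclass a. f a l * g l b)"
proof (rule eq_matI)
  fix r c
  assume "r < dim_row (blk (\<lambda>a b. \<Sum>l\<in>lclass a. f a l * g l b))"
    "c < dim_col (blk (\<lambda>a b. \<Sum>l\<in>lclass a. f a l * g l b))"
  then have rc: "r < 32" "c < 32" by simp_all
  let ?S = "{x. x < 32 \<and> qlab x = qlab r}"
  have "(blk f * blk g) $$ (r, c) = (\<Sum>x<32. blk f $$ (r, x) * blk g $$ (x, c))"
    by (rule mult_index_32[OF blk_carrier blk_carrier rc])
  also have "\<dots> = (\<Sum>x\<in>?S. blk f $$ (r, x) * blk g $$ (x, c))"
    using rc by (intro sum.mono_neutral_right) (auto simp: blk_index)
  also have "\<dots> = (\<Sum>x\<in>?S. if qlab r = qlab c then f (plab r) (plab x) * g (plab x) (plab c) else 0)"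
    using rc by (intro sum.cong) (auto simp: blk_index)
  also have "\<dots> = (\<Sum>l\<in>plab ` ?S. if qlab r = qlab c then f (plab r) l * g l (plab c) else 0)"
  proof (rule sum.reindex_cong[symmetric, of plab])
    show "inj_on plab ?S"
      by (rule inj_onI) (auto intro: label_inj)
  qed simp_all
  also have "\<dots> = blk (\<lambda>a b. \<Sum>l\<in>lclass a. f a l * g l b) $$ (r, c)"
    using rc by (simp add: plab_image_lclass blk_index)
  finally show "(blk f * blk g) $$ (r, c) = blk (\<lambda>a b. \<Sum>l\<in>lclass a. f a l * g l b) $$ (r, c)" .
qed simp_all

lemma lclass_eq:
  assumes "b \<in> lclass a"
  shows "lclass b = lclass a"
proof -
  consider "a = 1" | "a \<noteq> 1" "a < 8" | "8 \<le> a" "even a" | "8 \<le> a" "odd a"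
    by linarith
  then show ?thesis
  proof cases
    case 2
    then have "b \<noteq> 1 \<and> b < 8" using assms by (auto simp: lclass_def)
    then show ?thesis using 2 by (simp add: lclass_def)
  next
    case 3
    then have "8 \<le> b \<and> even b" using assms by (auto simp: lclass_def)
    then show ?thesis using 3 by (simp add: lclass_def)
  next
    case 4
    then have "8 \<le> b \<and> odd b" using assms by (auto simp: lclass_def)
    then show ?thesis using 4 by (simp add: lclass_def)
  qed (use assms in \<open>simp add: lclass_def\<close>)
qed

text \<open>The usual rule for matrix units. No relation between \<open>k\<close> and
  \<open>n\<close> is required: if they lie in different classes, \<open>lunit k n\<close> is zero
  and so is the left side.\<close>

lemma lunit_sandwich:
  assumes "l \<in> lclass k" "m \<in> lclass n"
  shows "lunit k l * blk f * lunit m n = f l m \<cdot>\<^sub>m lunit k n"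
proof -
  have "(\<Sum>x\<in>lclass a. (\<Sum>y\<in>lclass a. (if a = k \<and> y = l then 1 else 0) * f y x) * (if x = m \<and> b = n then 1 else 0))
     = f l m * (if a = k \<and> b = n then 1 else 0)" if "a < 16" "b \<in> lclass a" for a b
  proof (cases "a = k \<and> b = n")
    case True
    then have m: "m \<in> lclass k"
      using that assms lclass_eq by metis
    have "(\<Sum>x\<in>lclass k. (\<Sum>y\<in>lclass k. (if y = l then 1 else 0) * f y x) * (if x = m then 1 else 0)) = f l m"
      using assms m by (simp add: if_distrib[of "\<lambda>t. t * _"] if_distrib[of "\<lambda>t. _ * t"] cong: if_cong)
    then show ?thesis using True by simp
  qed auto
  then show ?thesis
    unfolding lunit_def blk_mult blk_smult by (intro blk_cong) simp
qed

lemma lunit_mult: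
  assumes "b \<in> lclass a"
  shows "lunit a b * lunit b c = lunit a c"
proof -
  have "(\<Sum>x\<in>lclass u. (if u = a \<and> x = b then 1 else 0) * (if x = b \<and> v = c then 1 else 0))
     = (if u = a \<and> v = c then 1 else (0::complex))" for u v
    using assms by (cases "u = a \<and> v = c")
      (simp_all add: if_distrib[of "\<lambda>t. t * _"] if_distrib[of "\<lambda>t. _ * t"] cong: if_cong)
  then show ?thesis
    unfolding lunit_def blk_mult by simp
qed

text \<open>The matrix units span the block algebra; the induction adds one label pair at a
  time.\<close>

lemma blk_in_span:
  assumes add: "\<And>x y. x \<in> X \<Longrightarrow> y \<in> X \<Longrightarrow> x + y \<in> X"
    and smult: "\<And>c x. x \<in> X \<Longrightarrow> c \<cdot>\<^sub>m x \<in> X"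
    and lunit: "\<And>a b. a \<in> lclass a \<Longrightarrow> b \<in> lclass a \<Longrightarrow> lunit a b \<in> X"
  shows "blk f \<in> X"
proof -
  have "blk (\<lambda>a b. if (a, b) \<in> F then f a b else 0) \<in> X"
    if "finite F" "F \<subseteq> (SIGMA a:{a. a < 16 \<and> a \<in> lclass a}. lclass a)" for F
    using that
  proof (induction F)
    case empty
    \<comment> \<open>The zero multiple of an arbitrary unit supplies the zero matrix.\<close>
    have "0 \<cdot>\<^sub>m lunit 0 0 \<in> X" by (intro smult lunit) (simp_all add: lclass_def)
    then show ?case by (simp add: lunit_def blk_smult)
  next
    case (insert p F)
    obtain u v where p: "p = (u, v)" by fastforce
    have "blk (\<lambda>a b. if (a, b) \<in> F then f a b else 0) + f u v \<cdot>\<^sub>m lunit u v \<in> X"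
      using insert p by (intro add smult lunit) auto
    moreover have "blk (\<lambda>a b. if (a, b) \<in> F then f a b else 0) + f u v \<cdot>\<^sub>m lunit u v
        = blk (\<lambda>a b. if (a, b) \<in> insert p F then f a b else 0)"
      unfolding lunit_def blk_smult blk_add using insert(2) p
      by (intro blk_cong) auto
    ultimately show ?case by simp
  qed
  from this[of "SIGMA a:{a. a < 16 \<and> a \<in> lclass a}. lclass a"]
  have "blk (\<lambda>a b. if (a, b) \<in> (SIGMA a:{a. a < 16 \<and> a \<in> lclass a}. lclass a) then f a b else 0) \<in> X"
    by simp
  also have "blk (\<lambda>a b. if (a, b) \<in> (SIGMA a:{a. a < 16 \<and> a \<in> lclass a}. lclass a) then f a b else 0) = blk f"
    by (rule blk_cong) simp
  finally show ?thesis .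
qed

abbreviation lunits :: "complex mat set" where
  "lunits \<equiv> range (\<lambda>(a, b). lunit a b)"

section \<open>The block algebra, its opposite and commutants\<close>

lemma commute_add:
  fixes x y k :: "complex mat"
  assumes "x \<in> carrier_mat n n" "y \<in> carrier_mat n n" "k \<in> carrier_mat n n"
    and "x * k = k * x" "y * k = k * y"
  shows "(x + y) * k = k * (x + y)"
proof -
  have "(x + y) * k = x * k + y * k"
    using assms(1-3) by (rule add_mult_distrib_mat)
  also have "\<dots> = k * (x + y)"
    unfolding assms(4,5) using assms(3,1,2) by (rule mult_add_distrib_mat[symmetric])
  finally show ?thesis .
qed

lemma commute_smult:
  fixes x k :: "complex mat"
  assumes "x \<in> carrier_mat n n" "k \<in> carrier_mat n n" "x * k = k * x"
  shows "(c \<cdot>\<^sub>m x) * k = k * (c \<cdot>\<^sub>m x)"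
proof -
  have "(c \<cdot>\<^sub>m x) * k = c \<cdot>\<^sub>m (x * k)"
    using assms(1,2) by (rule mult_smult_assoc_mat)
  also have "\<dots> = k * (c \<cdot>\<^sub>m x)"
    unfolding assms(3) using assms(2,1) by (rule mult_smult_distrib[symmetric])
  finally show ?thesis .
qed

lemma commutant_lunits: "commutant lunits = commutant (range blk)"
proof -
  have "\<xi> * blk f = blk f * \<xi>" if "\<xi> \<in> commutant lunits" for \<xi> f
  proof -
    have \<xi>: "\<xi> \<in> carrier_mat 32 32" and comm: "\<And>a b. \<xi> * lunit a b = lunit a b * \<xi>"
      using that by (auto simp: commutant_def End_H_def)
    have "blk f \<in> {\<eta> \<in> carrier_mat 32 32. \<eta> * \<xi> = \<xi> * \<eta>}"
    proof (rule blk_in_span)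
      fix a b show "lunit a b \<in> {\<eta> \<in> carrier_mat 32 32. \<eta> * \<xi> = \<xi> * \<eta>}"
        using comm[of a b] by simp
    qed (use \<xi> in \<open>auto intro: commute_add commute_smult\<close>)
    then show ?thesis by simp
  qed
  then show ?thesis
    by (auto simp: commutant_def End_H_def lunit_def)
qed

text \<open>The block algebra satisfies the Hodge property itself: it is the commutant of the
  opposite units, and applying the involution \<open>opp\<close> to this description gives the
  commutant of the units.\<close>

lemma opp_range_blk: "opp ` range blk = commutant (range blk)"
proof -
  have "opp ` range blk = commutant (opp ` opp ` lunits)"
    unfolding commutant_opp_lunit[symmetric] by (rule commutant_opp[symmetric]) auto
  also have "opp ` opp ` lunits = lunits"
    unfolding image_image by (rule image_cong[OF refl]) auto
  finally show ?thesis by (simp only: commutant_lunits)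
qed

lemma commutant_mult:
  assumes "x \<in> commutant K" "y \<in> commutant K" "K \<subseteq> carrier_mat 32 32"
  shows "x * y \<in> commutant K"
proof -
  have "x * y * k = k * (x * y)" if "k \<in> K" for k
  proof -
    have c: "x \<in> carrier_mat 32 32" "y \<in> carrier_mat 32 32" "k \<in> carrier_mat 32 32"
      and e: "x * k = k * x" "y * k = k * y"
      using assms that by (auto simp: commutant_def End_H_def)
    have "x * y * k = x * (k * y)"
      unfolding e(2)[symmetric] using c by (rule assoc_mult_mat)
    also have "\<dots> = k * x * y"
      unfolding e(1)[symmetric] using c(1,3,2) by (rule assoc_mult_mat[symmetric])
    also have "\<dots> = k * (x * y)"
      using c(3,1,2) by (rule assoc_mult_mat)
    finally show ?thesis .
  qed
  then show ?thesis using assms by (auto simp: commutant_def End_H_def)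
qed

text \<open>The commutant of a set closed under adjoints is a complex *-algebra, so it suffices to
  check the algebra and the commutators with \<open>D\<close>.\<close>

lemma ClD_subset_commutant:
  assumes A: "A \<subseteq> commutant K" and D: "\<And>b. b \<in> A \<Longrightarrow> D * b - b * D \<in> commutant K"
    and K: "K \<subseteq> carrier_mat 32 32" "\<And>k. k \<in> K \<Longrightarrow> adj k \<in> K"
  shows "ClD D A \<subseteq> commutant K"
proof
  fix x assume "x \<in> ClD D A"
  then show "x \<in> commutant K"
  proof induction
    case (gen_A a)
    then show ?case using A by auto
  next
    case (gen_comm a b)
    then show ?case using A D K(1) by (auto intro!: commutant_mult)
  next
    case (mult x y)
    then show ?case using K(1) by (intro commutant_mult)
  next
    case (add x y)
    then show ?case
      using K(1) by (auto simp: commutant_def End_H_def intro!: commute_add[of _ 32])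
  next
    case (smult x c)
    then show ?case
      using K(1) by (auto simp: commutant_def End_H_def intro!: commute_smult[of _ 32])
  next
    case (star x)
    have "adj x * k = k * adj x" if "k \<in> K" for k
    proof -
      have c: "x \<in> carrier_mat 32 32" "k \<in> carrier_mat 32 32" "adj k \<in> carrier_mat 32 32"
        and e: "x * adj k = adj k * x"
        using star.IH that K by (auto simp: commutant_def End_H_def)
      have "adj x * k = adj (adj k * x)"
        using c by (simp add: adj_mult)
      also have "\<dots> = k * adj x"
        unfolding e[symmetric] using c by (simp add: adj_mult)
      finally show ?thesis .
    qed
    then show ?case using star by (auto simp: commutant_def End_H_def)
  qed
qed

subsection \<open>The algebra and the Dirac operator\<close>

text \<open>\<open>x\<close> acts on the column \<open>j = 0\<close> and \<open>y\<close> on the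
  three other columns, whose labels are shifted by 8.\<close>

definition pairf :: "(nat \<Rightarrow> nat \<Rightarrow> complex) \<Rightarrow> (nat \<Rightarrow> nat \<Rightarrow> complex) \<Rightarrow> nat \<Rightarrow> nat \<Rightarrow> complex" where
  "pairf x y a b = (if a < 8 \<and> b < 8 then x a b else if 8 \<le> a \<and> 8 \<le> b then y (a - 8) (b - 8) else 0)"

text \<open>An operator that preserves columns and agrees on the last three lies in the block
  algebra under these conditions: the seven vectors labelled 1 must be decoupled and carry one
  common scalar, and \<open>y\<close> must not mix even and odd positions.\<close>

lemma eq_blk_pairf:
  assumes \<xi>: "\<xi> \<in> carrier_mat 32 32"
    and ent: "\<And>s j t k. s < 8 \<Longrightarrow> j < 4 \<Longrightarrow> t < 8 \<Longrightarrow> k < 4 \<Longrightarrow>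
      \<xi> $$ (4 * s + j, 4 * t + k) = (if j \<noteq> k then 0 else if j = 0 then x s t else y s t)"
    and x1: "\<And>s. s < 8 \<Longrightarrow> s \<noteq> 1 \<Longrightarrow> x s 1 = 0" "\<And>s. s < 8 \<Longrightarrow> s \<noteq> 1 \<Longrightarrow> x 1 s = 0"
    and y1: "y 0 0 = x 1 1" "y 1 1 = x 1 1"
    and y2: "\<And>s t. s < 8 \<Longrightarrow> t < 8 \<Longrightarrow> s \<noteq> t \<Longrightarrow> s < 2 \<or> t < 2 \<or> s mod 2 \<noteq> t mod 2 \<Longrightarrow> y s t = 0"
  shows "\<xi> = blk (pairf x y)"
proof (rule eq_matI)
  fix r c assume "r < dim_row (blk (pairf x y))" "c < dim_col (blk (pairf x y))"
  then have rc: "r < 32" "c < 32" by simp_all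
  obtain s j where r: "r = 4 * s + j" "s < 8" "j < 4"
    using nat_less_32_cases[OF rc(1)] .
  obtain t k where c: "c = 4 * t + k" "t < 8" "k < 4"
    using nat_less_32_cases[OF rc(2)] .
  have e: "\<xi> $$ (r, c) = (if j \<noteq> k then 0 else if j = 0 then x s t else y s t)"
    unfolding r(1) c(1) using r c by (intro ent)
  have b: "blk (pairf x y) $$ (r, c) = (if qlab r = qlab c then pairf x y (plab r) (plab c) else 0)"
    using rc by (rule blk_index)
  \<comment> \<open>\<open>A\<close>, \<open>B\<close> and \<open>C\<close> are the vectors of the
    seven-dimensional factor, those labelled 1, and those of the two three-dimensional factors. Rows
    and columns are compared kind by kind.\<close>
  have A: "plab (4 * s + j) = s \<and> qlab (4 * s + j) = 1" if "s < 8" "j = 0" "s \<noteq> 1" for s j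
    using that plab_coord[of j s] qlab_coord[of s j] by auto
  have B: "plab (4 * s + j) = 1 \<and> qlab (4 * s + j) \<noteq> 1 \<and> qlab (4 * s + j) < 8" if "s < 2" "j \<noteq> 0 \<or> s = 1" "j < 4" for s j
    using that plab_coord[of j s] qlab_coord[of s j] by auto
  have C: "plab (4 * s + j) = 8 + s \<and> qlab (4 * s + j) = 8 + 2 * j + (1 - s mod 2) \<and> 8 < qlab (4 * s + j)"
    if "2 \<le> s" "s < 8" "j \<noteq> 0" "j < 4" for s j
    using that plab_coord[of j s] qlab_coord[of s j] by auto
  consider "j = 0" "s \<noteq> 1" | "s < 2" "j \<noteq> 0 \<or> s = 1" | "2 \<le> s" "j \<noteq> 0" by linarith
  note rcase = this
  consider "k = 0" "t \<noteq> 1" | "t < 2" "k \<noteq> 0 \<or> t = 1" | "2 \<le> t" "k \<noteq> 0" by linarith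
  note ccase = this
  show "\<xi> $$ (r, c) = blk (pairf x y) $$ (r, c)"
  proof (rule rcase)
    assume rA: "j = 0" "s \<noteq> 1"
    show ?thesis
    proof (rule ccase)
      assume "k = 0" "t \<noteq> 1"
      then show ?thesis unfolding e b using A[of s j] A[of t k] rA r c by (simp add: pairf_def)
    next
      assume h: "t < 2" "k \<noteq> 0 \<or> t = 1"
      then have "j \<noteq> k \<or> t = 1" using rA by auto
      then show ?thesis unfolding e b using A[of s j] B[of t k] rA r c h x1(1)[of s] by auto
    next
      assume "2 \<le> t" "k \<noteq> 0"
      then show ?thesis unfolding e b using A[of s j] C[of t k] rA r c by auto
    qed
  next
    assume rB: "s < 2" "j \<noteq> 0 \<or> s = 1"
    show ?thesis
    proof (rule ccase)
      assume h: "k = 0" "t \<noteq> 1"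
      then have "j \<noteq> k \<or> s = 1" using rB by auto
      then show ?thesis unfolding e b using B[of s j] A[of t k] rB r c h x1(2)[of t] by auto
    next
      assume h: "t < 2" "k \<noteq> 0 \<or> t = 1"
      show ?thesis
      proof (cases "r = c")
        case True
        then have "s = t" "j = k"
          using r c coord_div(2,3)[of j s] coord_div(2,3)[of k t] by simp_all
        moreover have "s = 0 \<or> s = 1" using rB by linarith
        ultimately show ?thesis unfolding e b using B[of s j] rB r True y1 by (auto simp: pairf_def)
      next
        case False
        then have "qlab r \<noteq> qlab c"
          using label_inj[OF rc] B[of s j] B[of t k] rB h r c by auto
        moreover have "j \<noteq> k \<or> s \<noteq> t \<and> j \<noteq> 0"
          using False r(1) c(1) rB h by auto
        ultimately show ?thesis unfolding e b using y2[of s t] rB r c by auto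
      qed
    next
      assume h: "2 \<le> t" "k \<noteq> 0"
      then show ?thesis unfolding e b using B[of s j] C[of t k] rB r c y2[of s t] by auto
    qed
  next
    assume rC: "2 \<le> s" "j \<noteq> 0"
    show ?thesis
    proof (rule ccase)
      assume "k = 0" "t \<noteq> 1"
      then show ?thesis unfolding e b using C[of s j] A[of t k] rC r c by auto
    next
      assume "t < 2" "k \<noteq> 0 \<or> t = 1"
      then show ?thesis unfolding e b using C[of s j] B[of t k] rC r c y2[of s t] by auto
    next
      assume h: "2 \<le> t" "k \<noteq> 0"
      have q: "qlab r = qlab c \<longleftrightarrow> j = k \<and> s mod 2 = t mod 2"
      proof
        assume "qlab r = qlab c"
        then have *: "8 + 2 * j + (1 - s mod 2) = 8 + 2 * k + (1 - t mod 2)"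
          using C[of s j] C[of t k] rC h r c by simp
        then show "j = k \<and> s mod 2 = t mod 2"
          by (intro conjI parity_coord_inj[OF *])
      next
        assume "j = k \<and> s mod 2 = t mod 2"
        then show "qlab r = qlab c" using C[of s j] C[of t k] rC h r c by simp
      qed
      show ?thesis unfolding e b q
        using C[of s j] C[of t k] rC h r c y2[of s t] by (auto simp: pairf_def)
    qed
  qed
qed (use \<xi> in simp_all)

section \<open>Matrix entries of the algebra and of the Dirac operator\<close>

lemma tens3_carrier [simp]: "tens3 x m y \<in> carrier_mat 32 32"
  by (simp add: tens3_def)

lemma tens3_dim [simp]: "dim_row (tens3 x m y) = 32" "dim_col (tens3 x m y) = 32"
  by (simp_all add: tens3_def)

lemma tens3_index:
  assumes "s < 8" "j < 4" "t < 8" "k < 4"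
  shows "tens3 x m y $$ (4 * s + j, 4 * t + k) =
    x $$ (s div 2, t div 2) * m $$ (s mod 2, t mod 2) * y $$ (j, k)"
  using assms by (simp add: tens3_def coord_div)

lemma munit_index: "r < n \<Longrightarrow> c < n \<Longrightarrow> munit n i j $$ (r, c) = (if r = i - 1 \<and> c = j - 1 then 1 else 0)"
  by (simp add: munit_def)

lemma munit_dim [simp]: "dim_row (munit n i j) = n" "dim_col (munit n i j) = n"
  by (simp_all add: munit_def)

text \<open>The positions 0 and 1 carry the scalar, 2 its conjugate, 4 and 6 the quaternion, and 3,
  5, 7 the 3 by 3 matrix. The subtractions turn \<open>s div 2\<close> into an index of the small
  matrix.\<close>

definition Af :: "complex \<Rightarrow> complex mat \<Rightarrow> complex mat \<Rightarrow> nat \<Rightarrow> nat \<Rightarrow> complex" where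
  "Af l q m s t = (if s < 2 \<or> t < 2 then (if s = t then l else 0)
     else if s mod 2 \<noteq> t mod 2 then 0
     else if odd s then m $$ (s div 2 - 1, t div 2 - 1)
     else if s = 2 \<or> t = 2 then (if s = t then cnj l else 0)
     else q $$ (s div 2 - 2, t div 2 - 2))"

definition A_elem :: "complex \<Rightarrow> complex mat \<Rightarrow> complex mat \<Rightarrow> complex mat" where
  "A_elem l q m = tens3 (diag_ssq l (cnj l) q) (munit 2 1 1) (1\<^sub>m 4)
           + tens3 (diag_sm l m) (munit 2 2 2) (1\<^sub>m 4)"

lemma A_elem_index:
  assumes "s < 8" "j < 4" "t < 8" "k < 4"
  shows "A_elem l q m $$ (4 * s + j, 4 * t + k) = (if j \<noteq> k then 0 else Af l q m s t)"
proof -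
  have "diag_ssq l (cnj l) q $$ (s div 2, t div 2) * munit 2 1 1 $$ (s mod 2, t mod 2) +
        diag_sm l m $$ (s div 2, t div 2) * munit 2 2 2 $$ (s mod 2, t mod 2) = Af l q m s t"
    using less_8_cases[OF assms(1)] less_8_cases[OF assms(3)]
    by (elim disjE) (simp_all add: Af_def diag_ssq_def diag_sm_def munit_index)
  then show ?thesis
    using assms by (simp add: A_elem_def tens3_index)
qed

lemma A_elem_carrier [simp]: "A_elem l q m \<in> carrier_mat 32 32"
  by (simp add: A_elem_def)

lemma A_elem_blk: "A_elem l q m = blk (pairf (Af l q m) (Af l q m))"
  by (rule eq_blk_pairf) (auto simp: A_elem_index Af_def)

lemma algA_eq: "algA = {A_elem l (quat z w) m | l z w m. m \<in> carrier_mat 3 3}"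
  by (simp add: algA_def A_elem_def)

text \<open>The edges of the graph that start at the vertices 0 and 2; \<open>herm\<close> adds the
  reversed edges with conjugate weights.\<close>

definition hop :: "complex list \<Rightarrow> complex list \<Rightarrow> nat \<Rightarrow> nat \<Rightarrow> complex" where
  "hop u v s t = (if s = 0 then u ! t else if s = 2 then v ! t else 0)"

definition herm :: "(nat \<Rightarrow> nat \<Rightarrow> complex) \<Rightarrow> nat \<Rightarrow> nat \<Rightarrow> complex" where
  "herm h s t = h s t + cnj (h t s)"

lemma Xmat_mat2_index:
  assumes "r < 4" "s < 4"
  shows "Xmat (mat2 a b c d) $$ (r, s) =
    (if r < 2 then if s < 2 then 0 else if r = 0 then if s = 2 then a else b else if s = 2 then c else d
     else if s < 2 then cnj (if s = 0 then if r = 2 then a else b else if r = 2 then c else d) else 0)"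
  using assms by (auto simp: Xmat_def mat2_def adj_def)

text \<open>Even positions of the lists come from the X matrices and odd ones from Y. The zero at
  position 1 of the second list is \<delta>_21, and the vanishing of \<beta>_13 and \<beta>_14
  empties the first list of \<open>y\<close>. This decouples label 1 as \<open>eq_blk_pairf\<close>
  demands.\<close>

lemma D0_blk:
  "D0 (mat2 a13 a14 a23 a24) (mat2 0 0 b23 b24) (Ymat d12 d13 d14 0 d22 d23 d24) =
   blk (pairf (herm (hop [0,0,0,d12,a13,d13,a14,d14] [0,0,0,d22,a23,d23,a24,d24]))
              (herm (hop [0,0,0,0,0,0,0,0] [0,0,0,0,b23,0,b24,0])))"
  (is "?D = blk (pairf ?x ?y)")
proof (rule eq_blk_pairf)
  show "?D \<in> carrier_mat 32 32" by (simp add: D0_def)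
next
  fix s j t k :: nat assume b: "s < 8" "j < 4" "t < 8" "k < 4"
  let ?Xa = "Xmat (mat2 a13 a14 a23 a24)" and ?Xb = "Xmat (mat2 0 0 b23 b24)"
    and ?Y = "Ymat d12 d13 d14 0 d22 d23 d24"
  have "?D $$ (4 * s + j, 4 * t + k) = (if j \<noteq> k then 0 else if j = 0 then
      ?Xa $$ (s div 2, t div 2) * munit 2 1 1 $$ (s mod 2, t mod 2)
      + ?Y $$ (s div 2, t div 2) * munit 2 1 2 $$ (s mod 2, t mod 2)
      + adj ?Y $$ (s div 2, t div 2) * munit 2 2 1 $$ (s mod 2, t mod 2)
      else ?Xb $$ (s div 2, t div 2) * munit 2 1 1 $$ (s mod 2, t mod 2))"
    using b by (simp add: D0_def tens3_index munit_index)
  moreover have "?Xa $$ (s div 2, t div 2) * munit 2 1 1 $$ (s mod 2, t mod 2)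
      + ?Y $$ (s div 2, t div 2) * munit 2 1 2 $$ (s mod 2, t mod 2)
      + adj ?Y $$ (s div 2, t div 2) * munit 2 2 1 $$ (s mod 2, t mod 2) = ?x s t"
    using less_8_cases[OF b(1)] less_8_cases[OF b(3)]
    by (elim disjE) (simp_all add: munit_index Xmat_mat2_index adj_def Ymat_def herm_def hop_def)
  moreover have "?Xb $$ (s div 2, t div 2) * munit 2 1 1 $$ (s mod 2, t mod 2) = ?y s t"
    using less_8_cases[OF b(1)] less_8_cases[OF b(3)]
    by (elim disjE) (simp_all add: munit_index Xmat_mat2_index herm_def hop_def)
  ultimately show "?D $$ (4 * s + j, 4 * t + k) = (if j \<noteq> k then 0 else if j = 0 then ?x s t else ?y s t)"
    by (simp only:)
next
  fix s :: nat assume "s < 8" "s \<noteq> 1"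
  from less_8_cases[OF this(1)] show "?x s 1 = 0" "?x 1 s = 0"
    by (elim disjE; simp add: herm_def hop_def)+
next
  show "?y 0 0 = ?x 1 1" "?y 1 1 = ?x 1 1"
    by (simp_all add: herm_def hop_def)
next
  fix s t :: nat assume st: "s < 8" "t < 8" and *: "s < 2 \<or> t < 2 \<or> s mod 2 \<noteq> t mod 2"
  have "s < 2 \<or> t < 2 \<or> s mod 2 \<noteq> t mod 2 \<longrightarrow> ?y s t = 0"
    using less_8_cases[OF st(1)] less_8_cases[OF st(2)]
    by (elim disjE) (simp_all add: herm_def hop_def)
  with * show "?y s t = 0" by (rule mp[rotated])
qed

lemma DR_index:
  assumes "r < 32" "c < 32"
  shows "DR u $$ (r, c) = (if r = 4 \<and> c = 0 then u else if r = 0 \<and> c = 4 then cnj u else 0)"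
proof -
  obtain s j where r: "r = 4 * s + j" "s < 8" "j < 4"
    using nat_less_32_cases[OF assms(1)] .
  obtain t k where c: "c = 4 * t + k" "t < 8" "k < 4"
    using nat_less_32_cases[OF assms(2)] .
  show ?thesis
    using less_8_cases[OF r(2)] less_8_cases[OF c(2)] r(3) c(3)
    unfolding r(1) c(1) DR_def
    by (simp only: tens3_index[OF r(2,3) c(2,3)]) (elim disjE; simp add: munit_index)
qed

lemma DR_carrier [simp]: "DR u \<in> carrier_mat 32 32"
  by (simp add: DR_def)

text \<open>\<open>DR u\<close> lives on the indices 0 and 4, on which every element of the algebra
  acts by the same scalar \<open>l\<close>.\<close>

lemma DR_commute: "DR u * A_elem l q m = A_elem l q m * DR u"
proof (rule eq_matI)
  let ?a = "A_elem l q m"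
  fix r c assume "r < dim_row (?a * DR u)" "c < dim_col (?a * DR u)"
  then have rc: "r < 32" "c < 32" by (simp_all add: A_elem_def DR_def)
  have row: "?a $$ (0, x) = (if x = 0 then l else 0)" "?a $$ (4, x) = (if x = 4 then l else 0)"
    "?a $$ (x, 0) = (if x = 0 then l else 0)" "?a $$ (x, 4) = (if x = 4 then l else 0)" if x32: "x < 32" for x
  proof -
    obtain t k where x: "x = 4 * t + k" "t < 8" "k < 4"
      using nat_less_32_cases[OF x32] .
    have "x = 0 \<longleftrightarrow> t = 0 \<and> k = 0" "x = 4 \<longleftrightarrow> t = 1 \<and> k = 0"
      using x(1,3) by presburger+
    then show "?a $$ (0, x) = (if x = 0 then l else 0)" "?a $$ (4, x) = (if x = 4 then l else 0)"
    "?a $$ (x, 0) = (if x = 0 then l else 0)" "?a $$ (x, 4) = (if x = 4 then l else 0)"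
      using A_elem_index[of 0 0 t k l q m] A_elem_index[of 1 0 t k l q m]
        A_elem_index[of t k 0 0 l q m] A_elem_index[of t k 1 0 l q m] x
      by (auto simp: Af_def)
  qed
  have "(DR u * ?a) $$ (r, c) = (\<Sum>x<32. DR u $$ (r, x) * ?a $$ (x, c))"
    using rc by (intro mult_index_32) simp_all
  \<comment> \<open>In a row other than 0 and 4 the coefficient is zero, so the index 4 assigned to
    it is a dummy.\<close>
  also have "\<dots> = (\<Sum>x<32. if x = (if r = 4 then 0 else 4) then
      (if r = 4 then u else if r = 0 then cnj u else 0) * ?a $$ (x, c) else 0)"
    using rc by (intro sum.cong) (auto simp: DR_index)
  also have "\<dots> = (if r = 4 then u else if r = 0 then cnj u else 0) * ?a $$ (if r = 4 then 0 else 4, c)"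
    by simp
  also have "\<dots> = ?a $$ (r, if c = 0 then 4 else 0) * (if c = 0 then u else if c = 4 then cnj u else 0)"
    using row[OF rc(1)] row[OF rc(2)] row[of 0] row[of 4] by simp
  also have "\<dots> = (\<Sum>x<32. if x = (if c = 0 then 4 else 0) then
      ?a $$ (r, x) * (if c = 0 then u else if c = 4 then cnj u else 0) else 0)"
    by simp
  also have "\<dots> = (\<Sum>x<32. ?a $$ (r, x) * DR u $$ (x, c))"
    using rc by (intro sum.cong) (auto simp: DR_index)
  also have "\<dots> = (?a * DR u) $$ (r, c)"
    using rc by (intro mult_index_32[symmetric]) simp_all
  finally show "(DR u * ?a) $$ (r, c) = (?a * DR u) $$ (r, c)" .
qed (simp_all add: A_elem_def DR_def)

section \<open>Reduction to \<open>D0\<close> and an upper bound for the Clifford algebra\<close>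

lemma add_mult_commute_diff:
  fixes X Y Z b :: "complex mat"
  assumes c: "X \<in> carrier_mat n n" "Y \<in> carrier_mat n n" "Z \<in> carrier_mat n n" "b \<in> carrier_mat n n"
    and "Y * b = b * Y" "Z * b = b * Z"
  shows "(X + Y + Z) * b - b * (X + Y + Z) = X * b - b * X"
proof -
  have "(X + Y + Z) * b = (X + Y) * b + Z * b"
    by (rule add_mult_distrib_mat[of _ n n _ _ n]) (use c in simp_all)
  moreover have "(X + Y) * b = X * b + Y * b"
    by (rule add_mult_distrib_mat[of _ n n _ _ n]) (use c in simp_all)
  moreover have "b * (X + Y + Z) = b * (X + Y) + b * Z"
    by (rule mult_add_distrib_mat[of _ n n _ n]) (use c in simp_all)
  moreover have "b * (X + Y) = b * X + b * Y"
    by (rule mult_add_distrib_mat[of _ n n _ n]) (use c in simp_all)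
  ultimately have "(X + Y + Z) * b - b * (X + Y + Z) = (X * b + Y * b + Z * b) - (b * X + Y * b + Z * b)"
    using assms(5,6) by simp
  also have "\<dots> = X * b - b * X"
  proof (rule eq_matI)
    fix i j assume "i < dim_row (X * b - b * X)" "j < dim_col (X * b - b * X)"
    then have "i < n" "j < n" using c by simp_all
    moreover have "dim_row X = n" "dim_row Y = n" "dim_row Z = n" "dim_row b = n"
      "dim_col X = n" "dim_col Y = n" "dim_col Z = n" "dim_col b = n" using c by simp_all
    ultimately show "((X * b + Y * b + Z * b) - (b * X + Y * b + Z * b)) $$ (i, j) = (X * b - b * X) $$ (i, j)"
      by (simp del: index_mult_mat(1))
  qed (use c in simp_all)
  finally show ?thesis .
qed

text \<open>The conjugate of \<open>D0\<close> under J is the opposite of a block matrix, hence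
  commutes with the block algebra and in particular with \<open>algA\<close>.\<close>

lemma Dirac_commutator:
  assumes "D0 al be Y = blk h" "b \<in> algA"
  shows "Dirac al be Y u * b - b * Dirac al be Y u = blk h * b - b * blk h"
proof -
  obtain l q m where b: "b = A_elem l q m"
    using assms(2) by (auto simp: algA_eq)
  have "Jconj (blk h) = opp (adj (blk h))"
    by (simp only: opp_def adj_adj[OF blk_carrier])
  also have "\<dots> \<in> commutant (range blk)"
    unfolding opp_range_blk[symmetric] adj_blk by blast
  finally have "Jconj (blk h) * b = b * Jconj (blk h)" "Jconj (blk h) \<in> carrier_mat 32 32"
    by (auto simp: commutant_def End_H_def b A_elem_blk)
  then show ?thesis
    unfolding Dirac_def assms(1)
    by (intro add_mult_commute_diff[of _ 32]) (simp_all add: b DR_commute)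
qed

lemma algA_carrier: "algA \<subseteq> carrier_mat 32 32"
  by (auto simp: algA_eq)

text \<open>The block algebra is the commutant of the opposite units, a set closed under adjoints,
  and it contains the generators.\<close>

lemma ClD_subset_blk:
  assumes D: "\<And>b. b \<in> algA \<Longrightarrow> D * b - b * D = blk h * b - b * blk h"
  shows "ClD D algA \<subseteq> range blk"
  unfolding commutant_opp_lunit[symmetric]
proof (rule ClD_subset_commutant)
  show "algA \<subseteq> commutant (opp ` lunits)"
    unfolding commutant_opp_lunit by (auto simp: algA_eq A_elem_blk)
  show "D * b - b * D \<in> commutant (opp ` lunits)" if "b \<in> algA" for b
    unfolding commutant_opp_lunit using that D[OF that]
    by (auto simp: algA_eq A_elem_blk blk_mult blk_diff)
  show "adj k \<in> opp ` lunits" if "k \<in> opp ` lunits" for k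
  proof -
    obtain a b where "k = opp (lunit a b)" using \<open>k \<in> opp ` lunits\<close> by auto
    then have "adj k = opp (case (b, a) of (x, y) \<Rightarrow> lunit x y)"
      by (simp add: opp_adj[symmetric] adj_lunit)
    then show ?thesis by blast
  qed
qed auto

lemma label_attained:
  assumes "a < 16" "a \<in> lclass a" "b \<in> lclass a"
  obtains r c where "r < 32" "c < 32" "qlab r = qlab c" "plab r = a" "plab c = b"
proof -
  \<comment> \<open>The column \<open>j = 0\<close> realises the labels below 8 and the column
    \<open>j = 1\<close> the shifted ones.\<close>
  define r where "r = (if a < 8 then 4 * a else 4 * (a - 8) + 1)"
  have "10 \<le> a" if "\<not> a < 8"
    using assms(2) that by (auto simp: lclass_def split: if_splits)
  then have r: "r < 32" "plab r = a"
    using assms(1) plab_coord[of 0 a] plab_coord[of 1 "a - 8"] by (force simp: r_def)+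
  have "b \<in> plab ` {x. x < 32 \<and> qlab x = qlab r}"
    unfolding plab_image_lclass[OF r(1)] r(2) by (rule assms(3))
  then obtain c where "c < 32" "qlab c = qlab r" "plab c = b"
    by blast
  then show thesis using that r by metis
qed

lemma sum_delta_mult:
  fixes f :: "nat \<Rightarrow> complex"
  assumes "finite L" "a \<in> L"
  shows "(\<Sum>l\<in>L. (if a = l \<and> P then 1 else 0) * f l) = (if P then f a else 0)"
    and "(\<Sum>l\<in>L. f l * (if l = a \<and> P then 1 else 0)) = (if P then f a else 0)"
proof -
  have "(\<Sum>l\<in>L. (if a = l \<and> P then 1 else 0) * f l) = (\<Sum>l\<in>L. if a = l then if P then f l else 0 else 0)"
    by (rule sum.cong) auto
  then show "(\<Sum>l\<in>L. (if a = l \<and> P then 1 else 0) * f l) = (if P then f a else 0)"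
    using assms by simp
  have "(\<Sum>l\<in>L. f l * (if l = a \<and> P then 1 else 0)) = (\<Sum>l\<in>L. if l = a then if P then f l else 0 else 0)"
    by (rule sum.cong) auto
  then show "(\<Sum>l\<in>L. f l * (if l = a \<and> P then 1 else 0)) = (if P then f a else 0)"
    using assms by simp
qed

subsection \<open>Disconnected graphs\<close>

text \<open>The projection onto the basis vectors whose \<open>plab\<close> lies in
  \<open>S\<close>.\<close>

definition lproj :: "nat set \<Rightarrow> complex mat" where
  "lproj S = blk (\<lambda>a b. if a = b \<and> a \<in> S then 1 else 0)"

lemma lproj_mult: "lproj S * blk f = blk (\<lambda>a b. if a \<in> S then f a b else 0)"
  unfolding lproj_def blk_mult
  by (rule blk_cong) (use sum_delta_mult(1) in simp)

lemma mult_lproj: "blk f * lproj S = blk (\<lambda>a b. if b \<in> S then f a b else 0)"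
  unfolding lproj_def blk_mult
proof (rule blk_cong)
  fix a b assume "b \<in> lclass a"
  then have "(\<Sum>l\<in>lclass a. f a l * (if l = b \<and> b \<in> S then 1 else 0)) = (if b \<in> S then f a b else 0)"
    by (intro sum_delta_mult(2)) simp_all
  moreover have "(\<Sum>l\<in>lclass a. f a l * (if l = b \<and> b \<in> S then 1 else 0))
      = (\<Sum>l\<in>lclass a. f a l * (if l = b \<and> l \<in> S then 1 else 0))"
    by (rule sum.cong) auto
  ultimately show "(\<Sum>l\<in>lclass a. f a l * (if l = b \<and> l \<in> S then 1 else 0)) = (if b \<in> S then f a b else 0)"
    by simp
qed

lemma lproj_commute:
  assumes "\<And>a b. a < 16 \<Longrightarrow> b < 16 \<Longrightarrow> b \<in> lclass a \<Longrightarrow> (a \<in> S) \<noteq> (b \<in> S) \<Longrightarrow> f a b = 0"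
  shows "blk f * lproj S = lproj S * blk f"
  unfolding lproj_mult mult_lproj by (rule blk_cong) (use assms in auto)

text \<open>If neither the algebra nor \<open>h\<close> links \<open>S\<close> to its complement,
  \<open>lproj S\<close> commutes with the Clifford algebra. The Hodge property would place it in
  the opposite block algebra, making it commute with \<open>lunit a b\<close>, which leads across
  the cut.\<close>

lemma not_Hodge_if_cut:
  assumes D: "\<And>b. b \<in> algA \<Longrightarrow> D * b - b * D = blk h * b - b * blk h"
    and h: "\<And>a b. a < 16 \<Longrightarrow> b < 16 \<Longrightarrow> b \<in> lclass a \<Longrightarrow> (a \<in> S) \<noteq> (b \<in> S) \<Longrightarrow> h a b = 0"
    and A: "\<And>l q m a b. a < 16 \<Longrightarrow> b < 16 \<Longrightarrow> b \<in> lclass a \<Longrightarrow> (a \<in> S) \<noteq> (b \<in> S) \<Longrightarrow>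
      pairf (Af l q m) (Af l q m) a b = 0"
    and ab: "a < 16" "a \<in> lclass a" "b \<in> lclass a" "a \<in> S" "b \<notin> S"
  shows "\<not> Hodge D algA"
proof
  assume "Hodge D algA"
  have A_comm: "x * lproj S = lproj S * x" if x: "x \<in> algA" for x
  proof -
    obtain l q m where x: "x = blk (pairf (Af l q m) (Af l q m))"
      using x by (auto simp: algA_eq A_elem_blk)
    show ?thesis unfolding x by (rule lproj_commute) (rule A)
  qed
  have lproj_c: "lproj S \<in> carrier_mat 32 32"
    by (simp add: lproj_def)
  have "ClD D algA \<subseteq> commutant {lproj S}"
  proof (rule ClD_subset_commutant)
    show "algA \<subseteq> commutant {lproj S}"
      using A_comm algA_carrier unfolding commutant_def End_H_def by blast
    then have b: "b \<in> commutant {lproj S}" if "b \<in> algA" for b using that by blast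
    have hc: "blk h \<in> commutant {lproj S}"
      using lproj_commute[OF h] by (auto simp: commutant_def End_H_def)
    show "D * b - b * D \<in> commutant {lproj S}" if "b \<in> algA" for b
    proof -
      have "blk h * b \<in> commutant {lproj S}" "b * blk h \<in> commutant {lproj S}"
        using b[OF that] hc lproj_c by (auto intro!: commutant_mult)
      then have c: "blk h * b \<in> carrier_mat 32 32" "b * blk h \<in> carrier_mat 32 32"
        "blk h * b * lproj S = lproj S * (blk h * b)" "b * blk h * lproj S = lproj S * (b * blk h)"
        unfolding commutant_def End_H_def by blast+
      have "(blk h * b - b * blk h) * lproj S = blk h * b * lproj S - b * blk h * lproj S"
        using c(1,2) lproj_c by (rule minus_mult_distrib_mat)
      also have "\<dots> = lproj S * (blk h * b - b * blk h)"
        unfolding c(3,4) using lproj_c c(1,2) by (rule mult_minus_distrib_mat[symmetric])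
      finally show ?thesis
        unfolding D[OF that] commutant_def End_H_def using minus_carrier_mat[OF c(2)] by simp
    qed
    have "adj (lproj S) = lproj S"
      unfolding lproj_def adj_blk by (rule blk_cong) auto
    then show "adj k \<in> {lproj S}" if "k \<in> {lproj S}" for k
      using that by simp
  qed (use lproj_c in simp)
  then have "lproj S \<in> commutant (ClD D algA)"
    using lproj_c unfolding commutant_def End_H_def by auto
  \<comment> \<open>The Hodge property turns the commutant into the opposite of the Clifford
    algebra, and the latter consists of block matrices.\<close>
  also have "commutant (ClD D algA) \<subseteq> opp ` range blk"
    using \<open>Hodge D algA\<close> ClD_subset_blk[OF D] unfolding Hodge_def by blast
  finally have "lproj S * lunit a b = lunit a b * lproj S"
    unfolding opp_range_blk commutant_lunits[symmetric] by (auto simp: commutant_def)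
  moreover obtain r c where rc: "r < 32" "c < 32" "qlab r = qlab c" "plab r = a" "plab c = b"
    using label_attained[OF ab(1-3)] .
  ultimately have "blk (\<lambda>x y. if x \<in> S then if x = a \<and> y = b then 1 else 0 else 0) $$ (r, c)
     = blk (\<lambda>x y. if y \<in> S then if x = a \<and> y = b then 1 else 0 else 0) $$ (r, c)"
    unfolding lunit_def lproj_mult mult_lproj by simp
  then show False
    using rc ab by (simp add: blk_index)
qed

text \<open>The Clifford algebra then equals the block algebra, for which the property is
  \<open>opp_range_blk\<close>.\<close>

lemma Hodge_if_lunits:
  assumes "ClD D A \<subseteq> range blk"
    and "\<And>a b. a \<in> lclass a \<Longrightarrow> b \<in> lclass a \<Longrightarrow> lunit a b \<in> ClD D A"
  shows "Hodge D A"
proof -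
  have "blk f \<in> ClD D A" for f
    using assms(2) by (intro blk_in_span) (auto intro: ClD.intros)
  then have "ClD D A = range blk"
    using assms(1) by blast
  then show ?thesis
    by (simp only: Hodge_def opp_range_blk)
qed

definition hopf :: "complex list \<Rightarrow> complex list \<Rightarrow> complex list \<Rightarrow> nat \<Rightarrow> nat \<Rightarrow> complex" where
  "hopf u v w = pairf (herm (hop u v)) (herm (hop [0,0,0,0,0,0,0,0] w))"

text \<open>The vertices that the algebra itself links: a cut must keep each of these sets on one
  side.\<close>

lemma Af_pairf_block:
  assumes "a < 16" "b < 16" "b \<in> lclass a" "pairf (Af l q m) (Af l q m) a b \<noteq> 0"
  shows "a = b \<or> {a, b} \<subseteq> {4, 6} \<or> {a, b} \<subseteq> {3, 5, 7} \<or> {a, b} \<subseteq> {12, 14} \<or> {a, b} \<subseteq> {11, 13, 15}"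
proof -
  have *: "s = t \<or> {s, t} \<subseteq> {4, 6} \<or> {s, t} \<subseteq> {3, 5, 7}" if "s < 8" "t < 8" "Af l q m s t \<noteq> 0" for s t
    using less_8_cases[OF that(1)] less_8_cases[OF that(2)] that(3)
    by (elim disjE) (simp_all add: Af_def)
  show ?thesis
  proof (cases "a < 8")
    case True
    then show ?thesis using *[of a b] assms(4) by (auto simp: pairf_def split: if_splits)
  next
    case False
    then have "8 \<le> b" "Af l q m (a - 8) (b - 8) \<noteq> 0"
      using assms(4) by (auto simp: pairf_def split: if_splits)
    then have "a - 8 = b - 8 \<or> {a - 8, b - 8} \<subseteq> {4, 6} \<or> {a - 8, b - 8} \<subseteq> {3, 5, 7}"
      using *[of "a - 8" "b - 8"] assms(1,2) False by simp
    then show ?thesis using False \<open>8 \<le> b\<close> by auto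
  qed
qed

text \<open>The 4-cycle runs through 0, {4, 6}, 2 and {3, 5, 7}. Each of the last six alternatives
  deletes two of its edges and takes for \<open>S\<close> one of the resulting pieces; the first one
  separates 10 from 12 and 14 when \<beta> vanishes. \<open>a\<close> and \<open>b\<close> lie in
  one class on the two sides of the cut.\<close>

lemma not_Hodge_if_zero_edges:
  fixes S :: "nat set" and a b :: nat
  assumes D: "\<And>b. b \<in> algA \<Longrightarrow> D * b - b * D = blk h * b - b * blk h"
    and h: "h = hopf [0,0,0,d12,a13,d13,a14,d14] [0,0,0,d22,a23,d23,a24,d24] [0,0,0,0,b23,0,b24,0]"
    and S: "b23 = 0 \<and> b24 = 0 \<and> S = {10} \<and> a = 10 \<and> b = 12
      \<or> a13 = 0 \<and> a14 = 0 \<and> a23 = 0 \<and> a24 = 0 \<and> S = {4, 6} \<and> a = 4 \<and> b = 0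
      \<or> a13 = 0 \<and> a14 = 0 \<and> d12 = 0 \<and> d13 = 0 \<and> d14 = 0 \<and> S = {0} \<and> a = 0 \<and> b = 2
      \<or> a13 = 0 \<and> a14 = 0 \<and> d22 = 0 \<and> d23 = 0 \<and> d24 = 0 \<and> S = {2, 4, 6} \<and> a = 2 \<and> b = 0
      \<or> a23 = 0 \<and> a24 = 0 \<and> d12 = 0 \<and> d13 = 0 \<and> d14 = 0 \<and> S = {0, 4, 6} \<and> a = 0 \<and> b = 2
      \<or> a23 = 0 \<and> a24 = 0 \<and> d22 = 0 \<and> d23 = 0 \<and> d24 = 0 \<and> S = {2} \<and> a = 2 \<and> b = 0
      \<or> d12 = 0 \<and> d13 = 0 \<and> d14 = 0 \<and> d22 = 0 \<and> d23 = 0 \<and> d24 = 0 \<and> S = {3, 5, 7} \<and> a = 3 \<and> b = 0"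
  shows "\<not> Hodge D algA"
proof (rule not_Hodge_if_cut[OF D, where S = S and a = a and b = b])
  show "a < 16" "a \<in> lclass a" "b \<in> lclass a" "a \<in> S" "b \<notin> S"
    using S by (elim disjE; simp add: lclass_def)+
  have S_block: "4 \<in> S \<longleftrightarrow> 6 \<in> S" "3 \<in> S \<longleftrightarrow> 5 \<in> S" "5 \<in> S \<longleftrightarrow> 7 \<in> S" "12 \<notin> S" "14 \<notin> S"
    "11 \<notin> S" "13 \<notin> S" "15 \<notin> S"
    using S by (elim disjE; simp)+
  show "pairf (Af l q m) (Af l q m) x y = 0"
    if "x < 16" "y < 16" "y \<in> lclass x" "(x \<in> S) \<noteq> (y \<in> S)" for l q m x y
  proof (rule ccontr)
    assume "pairf (Af l q m) (Af l q m) x y \<noteq> 0"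
    with Af_pairf_block[OF that(1-3)] that(4) S_block show False
      by auto
  qed
  have S_sub: "x \<in> S \<longrightarrow> x < 8 \<or> x = 10" for x
    using S by (elim disjE; auto)
  have *: "(s \<in> S) = (t \<in> S) \<or> herm (hop [0,0,0,d12,a13,d13,a14,d14] [0,0,0,d22,a23,d23,a24,d24]) s t = 0"
    if st: "s < 8" "t < 8" for s t
    using S less_8_cases[OF st(1)] less_8_cases[OF st(2)]
    by (elim disjE conjE) (simp_all add: herm_def hop_def)
  have **: "(s + 8 \<in> S) = (t + 8 \<in> S) \<or> herm (hop [0,0,0,0,0,0,0,0] [0,0,0,0,b23,0,b24,0]) s t = 0"
    if st: "s < 8" "t < 8" for s t
  proof (cases "b23 = 0 \<and> b24 = 0")
    case True
    then show ?thesis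
      using less_8_cases[OF st(1)] less_8_cases[OF st(2)]
      by (elim disjE conjE) (simp_all add: herm_def hop_def)
  next
    case False
    then have "10 \<notin> S" using S by auto
    then have "s + 8 \<notin> S" "t + 8 \<notin> S" using S_sub[of "s + 8"] S_sub[of "t + 8"] by auto
    then show ?thesis by simp
  qed
  show "h x y = 0" if xy: "x < 16" "y < 16" "y \<in> lclass x" "(x \<in> S) \<noteq> (y \<in> S)" for x y
  proof (cases "8 \<le> x \<and> 8 \<le> y")
    case True
    then show ?thesis
      using **[of "x - 8" "y - 8"] xy(1,2,4) by (auto simp: h hopf_def pairf_def)
  next
    case False
    then show ?thesis
      using *[of x y] xy(4) by (auto simp: h hopf_def pairf_def)
  qed
qed

subsection \<open>Connected graphs\<close>

text \<open>Elements of the algebra act by the same matrix on all columns, so one function serves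
  both halves of \<open>pairf\<close>.\<close>

definition dbl :: "(nat \<Rightarrow> nat \<Rightarrow> complex) \<Rightarrow> complex mat" where
  "dbl f = blk (pairf f f)"

text \<open>The complex span of the real algebra: the conjugate of \<open>l\<close> becomes an independent
  parameter and the quaternions become arbitrary 2 by 2 matrices.\<close>

definition Bf :: "complex \<Rightarrow> complex \<Rightarrow> (nat \<Rightarrow> nat \<Rightarrow> complex) \<Rightarrow> (nat \<Rightarrow> nat \<Rightarrow> complex) \<Rightarrow> nat \<Rightarrow> nat \<Rightarrow> complex"
  where "Bf l l' q m s t = (if s < 2 \<or> t < 2 then (if s = t then l else 0)
     else if s mod 2 \<noteq> t mod 2 then 0
     else if odd s then m s t
     else if s = 2 \<or> t = 2 then (if s = t then l' else 0)
     else q s t)"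

lemma dbl_cong:
  assumes "\<And>s t. s < 8 \<Longrightarrow> t < 8 \<Longrightarrow> f s t = g s t"
  shows "dbl f = dbl g"
  unfolding dbl_def by (rule blk_cong) (use assms in \<open>auto simp: pairf_def\<close>)

lemma dbl_add_smult: "dbl f + c \<cdot>\<^sub>m dbl g = dbl (\<lambda>s t. f s t + c * g s t)"
  unfolding dbl_def blk_smult blk_add by (rule blk_cong) (auto simp: pairf_def)

text \<open>The witnesses solve \<open>l = l1 + \<i> * l2\<close> together with
  \<open>l' = cnj l1 + \<i> * cnj l2\<close>, and likewise for the two rows of a quaternion. The
  matrix \<open>m\<close> is already complex and goes into the first summand.\<close>

lemma Bf_decompose:
  obtains a1 a2 where "a1 \<in> algA" "a2 \<in> algA" "dbl (Bf l l' q m) = a1 + \<i> \<cdot>\<^sub>m a2"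
proof
  let ?l1 = "(l + cnj l') / 2" and ?l2 = "- \<i> * (l - cnj l') / 2"
    and ?q1 = "quat ((q 4 4 + cnj (q 6 6)) / 2) ((q 4 6 - cnj (q 6 4)) / 2)"
    and ?q2 = "quat (- \<i> * (q 4 4 - cnj (q 6 6)) / 2) (- \<i> * (q 4 6 + cnj (q 6 4)) / 2)"
    and ?m1 = "mat 3 3 (\<lambda>(i, j). m (2 * i + 3) (2 * j + 3))"
  show "A_elem ?l1 ?q1 ?m1 \<in> algA" "A_elem ?l2 ?q2 (0\<^sub>m 3 3) \<in> algA"
    unfolding algA_eq by (intro CollectI exI conjI, rule refl, simp)+
  show "dbl (Bf l l' q m) = A_elem ?l1 ?q1 ?m1 + \<i> \<cdot>\<^sub>m A_elem ?l2 ?q2 (0\<^sub>m 3 3)"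
    unfolding A_elem_blk dbl_def[symmetric] dbl_add_smult
  proof (rule dbl_cong)
    fix s t :: nat assume st: "s < 8" "t < 8"
    show "Bf l l' q m s t = Af ?l1 ?q1 ?m1 s t + \<i> * Af ?l2 ?q2 (0\<^sub>m 3 3) s t"
      using less_8_cases[OF st(1)] less_8_cases[OF st(2)]
      by (elim disjE) (simp_all add: Bf_def Af_def quat_def mat2_def field_simps)
  qed
qed

text \<open>With the unit available as left factor, the commutators with \<open>D\<close> themselves
  are generators.\<close>

lemma A_elem_one: "A_elem 1 (quat 1 0) (1\<^sub>m 3) = 1\<^sub>m 32"
proof (rule eq_matI)
  fix r c assume "r < dim_row (1\<^sub>m 32 :: complex mat)" "c < dim_col (1\<^sub>m 32 :: complex mat)"
  then have rc: "r < 32" "c < 32" by simp_all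
  obtain s j where r: "r = 4 * s + j" "s < 8" "j < 4"
    using nat_less_32_cases[OF rc(1)] .
  obtain t k where c: "c = 4 * t + k" "t < 8" "k < 4"
    using nat_less_32_cases[OF rc(2)] .
  have Af: "Af 1 (quat 1 0) (1\<^sub>m 3) s t = (if s = t then 1 else 0)"
    using less_8_cases[OF r(2)] less_8_cases[OF c(2)]
    by (elim disjE) (simp_all add: Af_def quat_def mat2_def)
  have ent: "A_elem 1 (quat 1 0) (1\<^sub>m 3) $$ (r, c) =
      (if j \<noteq> k then 0 else Af 1 (quat 1 0) (1\<^sub>m 3) s t)"
    unfolding r(1) c(1) using r(2,3) c(2,3) by (rule A_elem_index)
  have "r div 4 = s" "r mod 4 = j" "c div 4 = t" "c mod 4 = k"
    unfolding r(1) c(1) using r(3) c(3) by (simp_all only: coord_div)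
  then have "r = c \<longleftrightarrow> s = t \<and> j = k"
    using r(1) c(1) by metis
  then show "A_elem 1 (quat 1 0) (1\<^sub>m 3) $$ (r, c) = 1\<^sub>m 32 $$ (r, c)"
    unfolding ent Af using rc by simp
qed (simp_all add: A_elem_def)

section \<open>Closure properties of the Clifford algebra\<close>

context
  fixes D :: "complex mat" and h :: "nat \<Rightarrow> nat \<Rightarrow> complex"
  assumes D: "\<And>b. b \<in> algA \<Longrightarrow> D * b - b * D = blk h * b - b * blk h"
begin

lemma Cl_carrier: "x \<in> ClD D algA \<Longrightarrow> x \<in> carrier_mat 32 32"
  using ClD_subset_blk[OF D] by auto

lemma Cl_diff:
  assumes "x \<in> ClD D algA" "y \<in> ClD D algA"
  shows "x - y \<in> ClD D algA"
proof -
  have "x - y = x + (- 1) \<cdot>\<^sub>m y"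
    using assms[THEN Cl_carrier] by (intro eq_matI) auto
  then show ?thesis
    using assms by (simp add: ClD.add ClD.smult)
qed

lemma Cl_smultD:
  assumes "k \<cdot>\<^sub>m x \<in> ClD D algA" "k \<noteq> 0"
  shows "x \<in> ClD D algA"
proof -
  have "x = (1 / k) \<cdot>\<^sub>m (k \<cdot>\<^sub>m x)"
    using assms(2) by (intro eq_matI) auto
  then show ?thesis
    using ClD.smult[OF assms(1), of "1 / k"] by simp
qed

lemma Cl_Bf: "dbl (Bf l l' q m) \<in> ClD D algA"
proof -
  obtain a1 a2 where a: "a1 \<in> algA" "a2 \<in> algA" "dbl (Bf l l' q m) = a1 + \<i> \<cdot>\<^sub>m a2"
    by (rule Bf_decompose)
  show ?thesis
    unfolding a(3) by (intro ClD.intros a)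
qed

lemma Cl_commutator_A:
  assumes "b \<in> algA"
  shows "blk h * b - b * blk h \<in> ClD D algA"
proof -
  have "1\<^sub>m 32 \<in> algA"
    unfolding A_elem_one[symmetric] algA_eq by (intro CollectI exI conjI, rule refl, simp)
  from ClD.gen_comm[OF this assms, of D]
  have "1\<^sub>m 32 * (blk h * b - b * blk h) \<in> ClD D algA"
    unfolding D[OF assms] .
  moreover have "b \<in> carrier_mat 32 32"
    using assms algA_carrier by blast
  ultimately show ?thesis
    by (simp add: left_mult_one_mat[of _ 32 32])
qed

text \<open>The commutator is complex linear in its second argument, so it extends from the real
  algebra to its complex span.\<close>

lemma Cl_commutator_Bf: "blk h * dbl (Bf l l' q m) - dbl (Bf l l' q m) * blk h \<in> ClD D algA"
proof -
  obtain a1 a2 where a: "a1 \<in> algA" "a2 \<in> algA" "dbl (Bf l l' q m) = a1 + \<i> \<cdot>\<^sub>m a2"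
    by (rule Bf_decompose)
  have c: "a1 \<in> carrier_mat 32 32" "a2 \<in> carrier_mat 32 32"
    using a(1,2) algA_carrier by blast+
  let ?h = "blk h"
  have "?h * (a1 + \<i> \<cdot>\<^sub>m a2) = ?h * a1 + \<i> \<cdot>\<^sub>m (?h * a2)"
    using c mult_add_distrib_mat[of ?h 32 32 a1 32 "\<i> \<cdot>\<^sub>m a2"] mult_smult_distrib[of ?h 32 32 a2 32 \<i>]
    by simp
  moreover have "(a1 + \<i> \<cdot>\<^sub>m a2) * ?h = a1 * ?h + \<i> \<cdot>\<^sub>m (a2 * ?h)"
    using c add_mult_distrib_mat[of a1 32 32 "\<i> \<cdot>\<^sub>m a2" ?h 32] mult_smult_assoc_mat[of a2 32 32 ?h 32 \<i>]
    by simp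
  ultimately have "?h * (a1 + \<i> \<cdot>\<^sub>m a2) - (a1 + \<i> \<cdot>\<^sub>m a2) * ?h
      = (?h * a1 + \<i> \<cdot>\<^sub>m (?h * a2)) - (a1 * ?h + \<i> \<cdot>\<^sub>m (a2 * ?h))"
    by simp
  also have "\<dots> = (?h * a1 - a1 * ?h) + \<i> \<cdot>\<^sub>m (?h * a2 - a2 * ?h)"
  proof -
    have *: "(P + \<i> \<cdot>\<^sub>m Q) - (R + \<i> \<cdot>\<^sub>m S) = (P - R) + \<i> \<cdot>\<^sub>m (Q - S)"
      if "P \<in> carrier_mat 32 32" "Q \<in> carrier_mat 32 32" "R \<in> carrier_mat 32 32" "S \<in> carrier_mat 32 32"
      for P Q R S :: "complex mat"
      using that by (intro eq_matI) (auto simp: algebra_simps)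
    show ?thesis by (rule *) (use c in auto)
  qed
  finally show ?thesis
    unfolding a(3) by (simp only:) (intro ClD.intros Cl_commutator_A a)
qed

text \<open>For orthogonal \<open>f\<close> and \<open>g\<close>, \<open>f D g = f [D, g]\<close>.\<close>

lemma Cl_sandwich:
  assumes "f = dbl (Bf l1 l1' q1 m1)" "g = dbl (Bf l2 l2' q2 m2)" "f * g = 0\<^sub>m 32 32"
  shows "f * blk h * g \<in> ClD D algA"
proof -
  have c: "f \<in> carrier_mat 32 32" "g \<in> carrier_mat 32 32"
    by (simp_all add: assms dbl_def)
  have "f * (blk h * g - g * blk h) \<in> ClD D algA"
    unfolding assms(1,2) by (intro ClD.mult Cl_Bf Cl_commutator_Bf)
  also have "f * (blk h * g - g * blk h) = f * (blk h * g) - f * (g * blk h)"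
    using c by (intro mult_minus_distrib_mat) auto
  also have "f * (g * blk h) = f * g * blk h"
    using c by (intro assoc_mult_mat[symmetric]) auto
  also have "\<dots> = 0\<^sub>m 32 32"
    by (simp add: assms(3) left_mult_zero_mat[of _ 32 32])
  also have "f * (blk h * g) - 0\<^sub>m 32 32 = f * (blk h * g)"
    using c by (intro eq_matI) auto
  also have "\<dots> = f * blk h * g"
    using c by (intro assoc_mult_mat[symmetric]) auto
  finally show ?thesis .
qed

end

lemma lunit_dim [simp]: "dim_row (lunit a b) = 32" "dim_col (lunit a b) = 32"
  by (simp_all add: lunit_def)

lemma lunit_mult_neq: "b \<noteq> c \<Longrightarrow> lunit a b * lunit c d = 0\<^sub>m 32 32"
proof -
  assume "b \<noteq> c"
  then have "lunit a b * lunit c d = blk (\<lambda>_ _. 0)"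
    unfolding lunit_def blk_mult by (intro blk_cong sum.neutral) auto
  also have "\<dots> = 0\<^sub>m 32 32"
    by (rule eq_matI) (auto simp: blk_index)
  finally show ?thesis .
qed

text \<open>The scalar acts on the vertex 0 and on label 1 alike, so the span contains only the sum
  of the two units. The shifted labels 8 and 9 contribute nothing.\<close>

lemma dbl_lambda: "dbl (Bf 1 0 (\<lambda>_ _. 0) (\<lambda>_ _. 0)) = lunit 0 0 + lunit 1 1"
proof -
  have Bf: "Bf 1 0 (\<lambda>_ _. 0) (\<lambda>_ _. 0) = (\<lambda>s t. if s = t \<and> s < 2 then 1 else 0)"
    by (intro ext) (simp add: Bf_def)
  show ?thesis
    unfolding dbl_def lunit_def blk_add Bf
  proof (rule blk_cong)
    fix a b assume a: "a \<in> lclass a"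
    have "8 \<notin> lclass 8" "9 \<notin> lclass 9"
      by (simp_all add: lclass_def)
    then have "a \<noteq> 8" "a \<noteq> 9"
      using a by metis+
    then have "\<not> (8 \<le> a \<and> a - 8 < 2)" by linarith
    moreover have "a < 2 \<longleftrightarrow> a = 0 \<or> a = 1" by linarith
    ultimately show "pairf (\<lambda>s t. if s = t \<and> s < 2 then 1 else 0) (\<lambda>s t. if s = t \<and> s < 2 then 1 else 0) a b =
        (if a = 0 \<and> b = 0 then 1 else 0) + (if a = 1 \<and> b = 1 then 1 else 0)"
      by (auto simp: pairf_def)
  qed
qed

lemma dbl_lambda_bar: "dbl (Bf 0 1 (\<lambda>_ _. 0) (\<lambda>_ _. 0)) = lunit 2 2 + lunit 10 10"
proof -
  have Bf: "Bf 0 1 (\<lambda>_ _. 0) (\<lambda>_ _. 0) = (\<lambda>s t. if s = 2 \<and> t = 2 then 1 else 0)"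
    by (intro ext) (simp add: Bf_def)
  show ?thesis
    unfolding dbl_def lunit_def blk_add Bf by (rule blk_cong) (auto simp: pairf_def)
qed

lemma dbl_unit:
  assumes "3 \<le> s" "s < 8" "3 \<le> t" "t < 8" "s mod 2 = t mod 2"
  defines "\<delta> \<equiv> \<lambda>x y. if x = s \<and> y = t then 1 else 0"
  shows "dbl (Bf 0 0 \<delta> \<delta>) = lunit s t + lunit (8 + s) (8 + t)"
proof -
  have "Bf 0 0 \<delta> \<delta> = \<delta>"
    using assms by (intro ext) (auto simp: Bf_def \<delta>_def)
  then show ?thesis
    unfolding dbl_def lunit_def blk_add
    by (simp only:) (rule blk_cong, use assms in \<open>auto simp: pairf_def \<delta>_def\<close>)
qed

lemma add_sandwich:
  fixes A B M C E :: "complex mat"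
  assumes "A \<in> carrier_mat n n" "B \<in> carrier_mat n n" "M \<in> carrier_mat n n"
    "C \<in> carrier_mat n n" "E \<in> carrier_mat n n"
  shows "(A + B) * M * (C + E) = A * M * C + B * M * C + (A * M * E + B * M * E)"
proof -
  have 1: "(A + B) * M = A * M + B * M"
    using assms(1-3) by (rule add_mult_distrib_mat)
  have 2: "(A * M + B * M) * X = A * M * X + B * M * X" if "X \<in> carrier_mat n n" for X
    using assms that by (intro add_mult_distrib_mat[of _ n n]) auto
  have "(A * M + B * M) * (C + E) = (A * M + B * M) * C + (A * M + B * M) * E"
    using assms by (intro mult_add_distrib_mat[of _ n n]) auto
  then show ?thesis
    unfolding 1 using 2[OF assms(4)] 2[OF assms(5)] by simp
qed

lemma add_mult_add:
  fixes A B C E :: "complex mat"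
  assumes "A \<in> carrier_mat n n" "B \<in> carrier_mat n n" "C \<in> carrier_mat n n" "E \<in> carrier_mat n n"
  shows "(A + B) * (C + E) = A * C + B * C + (A * E + B * E)"
proof -
  have "(A + B) * X = A * X + B * X" if "X \<in> carrier_mat n n" for X
    using assms that by (intro add_mult_distrib_mat[of _ n n]) auto
  moreover have "(A + B) * (C + E) = (A + B) * C + (A + B) * E"
    using assms by (intro mult_add_distrib_mat[of _ n n]) auto
  ultimately show ?thesis using assms by simp
qed

section \<open>Matrix units obtained from edges\<close>

context
  fixes D :: "complex mat" and x y :: "nat \<Rightarrow> nat \<Rightarrow> complex"
  assumes D: "\<And>b. b \<in> algA \<Longrightarrow> D * b - b * D = blk (pairf x y) * b - b * blk (pairf x y)"
    and x1: "\<And>s. s < 8 \<Longrightarrow> x 1 s = 0"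
begin

text \<open>Sandwiching \<open>D\<close> between the projection at one vertex and a unit from
  \<open>s\<close> to \<open>t\<close> isolates one edge weight, and \<open>t\<close> is free within
  its component. In the first claim \<open>x 1 s = 0\<close> removes the term at label 1; in the
  second the edges at 2 and 10 still come as a sum.\<close>

lemma edge_in_Cl:
  assumes st: "3 \<le> s" "s < 8" "3 \<le> t" "t < 8" "s mod 2 = t mod 2"
  shows "x 0 s \<cdot>\<^sub>m lunit 0 t \<in> ClD D algA"
    and "x 2 s \<cdot>\<^sub>m lunit 2 t + y 2 s \<cdot>\<^sub>m lunit 10 (8 + t) \<in> ClD D algA"
proof -
  have cl: "s \<in> lclass t" "8 + s \<in> lclass (8 + t)"
  proof -
    have "s = 3 \<or> s = 4 \<or> s = 5 \<or> s = 6 \<or> s = 7" "t = 3 \<or> t = 4 \<or> t = 5 \<or> t = 6 \<or> t = 7"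
      using st by linarith+
    then show "s \<in> lclass t" "8 + s \<in> lclass (8 + t)"
      using st(5) by (elim disjE; simp add: lclass_def)+
  qed
  have self: "0 \<in> lclass 0" "1 \<in> lclass 1" "2 \<in> lclass 2" "10 \<in> lclass 10"
    by (simp_all add: lclass_def)
  let ?h = "blk (pairf x y)"
  let ?F = "lunit s t + lunit (8 + s) (8 + t)"
  have "(lunit 0 0 + lunit 1 1) * ?F = 0\<^sub>m 32 32"
    using st by (simp add: add_mult_add[of _ 32] lunit_mult_neq)
  then have "(lunit 0 0 + lunit 1 1) * ?h * ?F \<in> ClD D algA"
    by (intro Cl_sandwich[OF D dbl_lambda[symmetric] dbl_unit[OF st, symmetric]])
  also have "(lunit 0 0 + lunit 1 1) * ?h * ?F =
      pairf x y 0 s \<cdot>\<^sub>m lunit 0 t + pairf x y 1 s \<cdot>\<^sub>m lunit 1 t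
      + (pairf x y 0 (8 + s) \<cdot>\<^sub>m lunit 0 (8 + t) + pairf x y 1 (8 + s) \<cdot>\<^sub>m lunit 1 (8 + t))"
    by (simp only: add_sandwich[OF lunit_carrier lunit_carrier blk_carrier lunit_carrier lunit_carrier]
        lunit_sandwich self cl)
  also have "\<dots> = x 0 s \<cdot>\<^sub>m lunit 0 t"
    using st x1[of s] by (intro eq_matI) (auto simp: pairf_def)
  finally show "x 0 s \<cdot>\<^sub>m lunit 0 t \<in> ClD D algA" .
  have "(lunit 2 2 + lunit 10 10) * ?F = 0\<^sub>m 32 32"
    using st by (simp add: add_mult_add[of _ 32] lunit_mult_neq)
  then have "(lunit 2 2 + lunit 10 10) * ?h * ?F \<in> ClD D algA"
    by (intro Cl_sandwich[OF D dbl_lambda_bar[symmetric] dbl_unit[OF st, symmetric]])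
  also have "(lunit 2 2 + lunit 10 10) * ?h * ?F =
      pairf x y 2 s \<cdot>\<^sub>m lunit 2 t + pairf x y 10 s \<cdot>\<^sub>m lunit 10 t
      + (pairf x y 2 (8 + s) \<cdot>\<^sub>m lunit 2 (8 + t) + pairf x y 10 (8 + s) \<cdot>\<^sub>m lunit 10 (8 + t))"
    by (simp only: add_sandwich[OF lunit_carrier lunit_carrier blk_carrier lunit_carrier lunit_carrier]
        lunit_sandwich self cl)
  also have "\<dots> = x 2 s \<cdot>\<^sub>m lunit 2 t + y 2 s \<cdot>\<^sub>m lunit 10 (8 + t)"
    using st by (intro eq_matI) (auto simp: pairf_def)
  finally show "x 2 s \<cdot>\<^sub>m lunit 2 t + y 2 s \<cdot>\<^sub>m lunit 10 (8 + t) \<in> ClD D algA" .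
qed

lemma lunit_sym: "lunit a b \<in> ClD D algA \<Longrightarrow> lunit b a \<in> ClD D algA"
  using ClD.star[of "lunit a b" D algA] by (simp add: adj_lunit)

lemma lunit_trans:
  assumes "lunit a b \<in> ClD D algA" "lunit b c \<in> ClD D algA" "b \<in> lclass a"
  shows "lunit a c \<in> ClD D algA"
  using ClD.mult[OF assms(1,2)] lunit_mult[OF assms(3), of c] by simp

text \<open>Units compose along paths and reverse under adjoints, so connectedness yields all units
  of the seven-dimensional factor. Subtracting these from known sums then releases the units of the
  remaining factors.\<close>

lemma lunits_in_Cl:
  assumes y: "y 2 4 \<noteq> 0 \<or> y 2 6 \<noteq> 0" "\<And>s. odd s \<Longrightarrow> s < 8 \<Longrightarrow> y 2 s = 0"
    and E: "3 \<le> length (filter id [x 0 4 \<noteq> 0 \<or> x 0 6 \<noteq> 0, x 2 4 \<noteq> 0 \<or> x 2 6 \<noteq> 0,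
      x 0 3 \<noteq> 0 \<or> x 0 5 \<noteq> 0 \<or> x 0 7 \<noteq> 0, x 2 3 \<noteq> 0 \<or> x 2 5 \<noteq> 0 \<or> x 2 7 \<noteq> 0])"
    and a: "a \<in> lclass a" and b: "b \<in> lclass a"
  shows "lunit a b \<in> ClD D algA"
proof -
  let ?R = "\<lambda>a b. lunit a b \<in> ClD D algA"
  let ?ev = "\<lambda>s. s = 4 \<or> s = (6::nat)" and ?od = "\<lambda>s. s = 3 \<or> s = 5 \<or> s = (7::nat)"
  let ?K = "{0, 2, 3, 4, 5, 6, 7} :: nat set"
  have K: "lclass k = ?K" if "k \<in> ?K" for k
    using that by (auto simp: lclass_def)
  have tr: "?R a c" if "?R a b" "?R b c" "a \<in> ?K" "b \<in> ?K" for a b c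
    by (rule lunit_trans[OF that(1,2)]) (use that(4) K[OF that(3)] in simp)
  have refl: "?R a a" if "?R a b" "a \<in> ?K" "b \<in> ?K" for a b
    by (rule tr[OF that(1) lunit_sym[OF that(1)] that(2,3)])
  have ev: "x 0 s \<cdot>\<^sub>m lunit 0 t \<in> ClD D algA"
    "x 2 s \<cdot>\<^sub>m lunit 2 t + y 2 s \<cdot>\<^sub>m lunit 10 (8 + t) \<in> ClD D algA" if "?ev s" "?ev t" for s t
    by (rule edge_in_Cl; use that in auto)+
  have od: "x 0 s \<cdot>\<^sub>m lunit 0 t \<in> ClD D algA"
    "x 2 s \<cdot>\<^sub>m lunit 2 t + y 2 s \<cdot>\<^sub>m lunit 10 (8 + t) \<in> ClD D algA" if "?od s" "?od t" for s t
    by (rule edge_in_Cl; use that in auto)+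
  have E1: "?R 0 t" if "x 0 4 \<noteq> 0 \<or> x 0 6 \<noteq> 0" "?ev t" for t
    using that(1) ev(1)[of 4 t] ev(1)[of 6 t] that(2) by (auto intro: Cl_smultD[OF D])
  have E3: "?R 0 t" if "x 0 3 \<noteq> 0 \<or> x 0 5 \<noteq> 0 \<or> x 0 7 \<noteq> 0" "?od t" for t
    using that(1) od(1)[of 3 t] od(1)[of 5 t] od(1)[of 7 t] that(2) by (auto intro: Cl_smultD[OF D])
  \<comment> \<open>At odd positions \<beta> has no edge, so the sum in \<open>edge_in_Cl\<close>
    has only its first term.\<close>
  have od2: "x 2 s \<cdot>\<^sub>m lunit 2 t \<in> ClD D algA" if "?od s" "?od t" for s t
  proof -
    have "odd s" "s < 8" using that by auto
    then have "x 2 s \<cdot>\<^sub>m lunit 2 t + y 2 s \<cdot>\<^sub>m lunit 10 (8 + t) = x 2 s \<cdot>\<^sub>m lunit 2 t"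
      using y(2)[of s] by (intro eq_matI) auto
    then show ?thesis using od(2)[OF that] by simp
  qed
  have E4: "?R 2 t" if "x 2 3 \<noteq> 0 \<or> x 2 5 \<noteq> 0 \<or> x 2 7 \<noteq> 0" "?od t" for t
    using that(1) od2[of 3 t] od2[of 5 t] od2[of 7 t] that(2) by (auto intro: Cl_smultD[OF D])
  \<comment> \<open>Multiplying by a projection at 2 or at \<open>t\<close> removes the \<beta>
    term. Such a projection must come from another edge, hence the extra premise.\<close>
  have E2: "?R 2 t" if e: "x 2 4 \<noteq> 0 \<or> x 2 6 \<noteq> 0" and t: "?ev t" and R: "?R 2 2 \<or> ?R t t" for t
  proof -
    have "x 2 s \<cdot>\<^sub>m lunit 2 t \<in> ClD D algA" if s: "?ev s" for s
      using R
    proof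
      assume "?R 2 2"
      from ClD.mult[OF this ev(2)[OF s t]]
      have "lunit 2 2 * (x 2 s \<cdot>\<^sub>m lunit 2 t + y 2 s \<cdot>\<^sub>m lunit 10 (8 + t)) \<in> ClD D algA" .
      also have "lunit 2 2 * (x 2 s \<cdot>\<^sub>m lunit 2 t + y 2 s \<cdot>\<^sub>m lunit 10 (8 + t))
          = x 2 s \<cdot>\<^sub>m (lunit 2 2 * lunit 2 t) + y 2 s \<cdot>\<^sub>m (lunit 2 2 * lunit 10 (8 + t))"
        by (simp add: mult_add_distrib_mat[of _ 32 32 _ 32] mult_smult_distrib[of _ 32 32 _ 32])
      also have "lunit 2 2 * lunit 2 t = lunit 2 t"
        by (rule lunit_mult) (simp add: lclass_def)
      also have "x 2 s \<cdot>\<^sub>m lunit 2 t + y 2 s \<cdot>\<^sub>m (lunit 2 2 * lunit 10 (8 + t)) = x 2 s \<cdot>\<^sub>m lunit 2 t"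
        by (intro eq_matI) (auto simp: lunit_mult_neq simp del: index_mult_mat(1))
      finally show ?thesis .
    next
      assume "?R t t"
      from ClD.mult[OF ev(2)[OF s t] this]
      have "(x 2 s \<cdot>\<^sub>m lunit 2 t + y 2 s \<cdot>\<^sub>m lunit 10 (8 + t)) * lunit t t \<in> ClD D algA" .
      also have "(x 2 s \<cdot>\<^sub>m lunit 2 t + y 2 s \<cdot>\<^sub>m lunit 10 (8 + t)) * lunit t t
          = x 2 s \<cdot>\<^sub>m (lunit 2 t * lunit t t) + y 2 s \<cdot>\<^sub>m (lunit 10 (8 + t) * lunit t t)"
        by (simp add: add_mult_distrib_mat[of _ 32 32 _ _ 32] mult_smult_assoc_mat[of _ 32 32 _ 32])
      also have "lunit 2 t * lunit t t = lunit 2 t"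
        by (rule lunit_mult) (use t in \<open>auto simp: lclass_def\<close>)
      also have "x 2 s \<cdot>\<^sub>m lunit 2 t + y 2 s \<cdot>\<^sub>m (lunit 10 (8 + t) * lunit t t) = x 2 s \<cdot>\<^sub>m lunit 2 t"
        by (intro eq_matI) (auto simp: lunit_mult_neq simp del: index_mult_mat(1))
      finally show ?thesis .
    qed
    from this[of 4] this[of 6] e show ?thesis
      by (auto intro: Cl_smultD[OF D])
  qed
  let ?E1 = "x 0 4 \<noteq> 0 \<or> x 0 6 \<noteq> 0" and ?E2 = "x 2 4 \<noteq> 0 \<or> x 2 6 \<noteq> 0"
    and ?E3 = "x 0 3 \<noteq> 0 \<or> x 0 5 \<noteq> 0 \<or> x 0 7 \<noteq> 0" and ?E4 = "x 2 3 \<noteq> 0 \<or> x 2 5 \<noteq> 0 \<or> x 2 7 \<noteq> 0"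
  \<comment> \<open>Three of the four edges: either both edges at the vertex 0 are present with one
    at 2, or both edges at 2 with one at 0. In each case a projection for \<open>E2\<close> is
    supplied by \<alpha>_1 or \<delta>_2.\<close>
  consider (13) ?E1 ?E3 "?E2 \<or> ?E4" | (234) ?E2 ?E3 ?E4 | (124) ?E1 ?E2 ?E4
    using E by (cases ?E1; cases ?E2; cases ?E3; cases ?E4) simp_all
  then have conn: "?R 0 2 \<and> (\<forall>t. ?ev t \<or> ?od t \<longrightarrow> ?R 0 t)"
  proof cases
    case 13
    have "?R 0 2"
      using 13(3)
    proof
      assume e2: ?E2
      have "?R 2 4" by (rule E2[OF e2]) (use refl[OF lunit_sym[OF E1[OF 13(1), of 4]]] in simp_all)
      then show ?thesis using tr[OF E1[OF 13(1), of 4] lunit_sym] by simp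
    next
      assume ?E4
      then have "?R 2 3" using E4 by simp
      then show ?thesis using tr[OF E3[OF 13(2), of 3] lunit_sym] by simp
    qed
    then show ?thesis using E1[OF 13(1)] E3[OF 13(2)] by blast
  next
    case 234
    have 22: "?R 2 2" using refl[OF E4[OF 234(3), of 3]] by simp
    have 02: "?R 0 2" using tr[OF E3[OF 234(2), of 3] lunit_sym[OF E4[OF 234(3), of 3]]] by simp
    have "?R 0 t" if "?ev t" for t
      using tr[OF 02 E2[OF 234(1) that]] 22 by simp
    then show ?thesis using 02 E3[OF 234(2)] by blast
  next
    case 124
    have 22: "?R 2 2" using refl[OF E4[OF 124(3), of 3]] by simp
    have 02: "?R 0 2" using tr[OF E1[OF 124(1), of 4] lunit_sym[OF E2[OF 124(2), of 4]]] 22 by simp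
    have "?R 0 t" if "?od t" for t
      using tr[OF 02 E4[OF 124(3) that]] by simp
    then show ?thesis using 02 E1[OF 124(1)] by blast
  qed
  have 0: "?R 0 k" if "k \<in> ?K" for k
    using that conn refl[of 0 2] by auto
  have RK: "?R k l" if "k \<in> ?K" "l \<in> ?K" for k l
    using tr[OF lunit_sym[OF 0[OF that(1)]] 0[OF that(2)]] that by simp
  \<comment> \<open>The span of the algebra provides only sums of a unit of the large factor and a
    unit elsewhere; with the former known the latter splits off.\<close>
  have sub: "?R c d" if "lunit a b + lunit c d \<in> ClD D algA" "?R a b" for a b c d
  proof -
    have "lunit c d = (lunit a b + lunit c d) - lunit a b"
      by (intro eq_matI) auto
    then show ?thesis using Cl_diff[OF D that] by simp
  qed
  have R11: "?R 1 1"
    using sub[OF _ 0[of 0]] Cl_Bf[OF D, of 1 0 "\<lambda>_ _. 0" "\<lambda>_ _. 0"] by (simp add: dbl_lambda)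
  have R10: "?R 10 10"
    using sub[OF _ RK[of 2 2]] Cl_Bf[OF D, of 0 1 "\<lambda>_ _. 0" "\<lambda>_ _. 0"] by (simp add: dbl_lambda_bar)
  have shift: "?R (8 + s) (8 + t)" if "?ev s \<and> ?ev t \<or> ?od s \<and> ?od t" for s t
  proof -
    have st: "3 \<le> s" "s < 8" "3 \<le> t" "t < 8" "s mod 2 = t mod 2" "s \<in> ?K" "t \<in> ?K"
      using that by auto
    have "lunit s t + lunit (8 + s) (8 + t) \<in> ClD D algA"
      unfolding dbl_unit[OF st(1-5), symmetric] by (rule Cl_Bf) (rule D)
    then show ?thesis
      using RK[OF st(6,7)] by (rule sub)
  qed
  \<comment> \<open>Now that all units \<open>lunit 2 t\<close> are available, the \<alpha>_2 term
    can be subtracted and a non-zero \<beta> weight joins 10 to 12 and 14.\<close>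
  have beta: "?R 10 (8 + t)" if t: "?ev t" for t
  proof -
    have "y 2 s \<cdot>\<^sub>m lunit 10 (8 + t) \<in> ClD D algA" if s: "?ev s" for s
    proof -
      have eq: "(x 2 s \<cdot>\<^sub>m lunit 2 t + y 2 s \<cdot>\<^sub>m lunit 10 (8 + t)) - x 2 s \<cdot>\<^sub>m lunit 2 t
          = y 2 s \<cdot>\<^sub>m lunit 10 (8 + t)"
        by (intro eq_matI) auto
      have "?R 2 t" using RK[of 2 t] t by auto
      from Cl_diff[OF D ev(2)[OF s t] ClD.smult[OF this, of "x 2 s"]] show ?thesis
        by (simp only: eq)
    qed
    from this[of 4] this[of 6] y(1) show ?thesis
      by (auto intro: Cl_smultD[OF D])
  qed
  have c2: "?R 10 12" "?R 10 14" "?R 12 10" "?R 14 10"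
    using beta[of 4] beta[of 6] lunit_sym by simp_all
  have c23: "?R 12 12" "?R 12 14" "?R 14 12" "?R 14 14"
    using shift[of 4 4] shift[of 4 6] shift[of 6 4] shift[of 6 6] by simp_all
  have c3: "?R 11 11" "?R 11 13" "?R 11 15" "?R 13 11" "?R 13 13" "?R 13 15" "?R 15 11" "?R 15 13" "?R 15 15"
    using shift[of 3 3] shift[of 3 5] shift[of 3 7] shift[of 5 3] shift[of 5 5] shift[of 5 7]
      shift[of 7 3] shift[of 7 5] shift[of 7 7] by simp_all
  consider "a = 1" | "a \<noteq> 1" "a < 8" | "8 \<le> a" "even a" | "8 \<le> a" "odd a" by linarith
  then show ?thesis
  proof cases
    case 1
    then show ?thesis using b R11 by (simp add: lclass_def)
  next
    case 2
    then have "a \<in> ?K" "b \<in> ?K" using a b by (simp_all add: lclass_def)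
    then show ?thesis by (rule RK)
  next
    case 3
    then have "a = 10 \<or> a = 12 \<or> a = 14" "b = 10 \<or> b = 12 \<or> b = 14"
      using a b by (simp_all add: lclass_def)
    then show ?thesis using R10 c2 c23 by (elim disjE; simp)
  next
    case 4
    then have "a = 11 \<or> a = 13 \<or> a = 15" "b = 11 \<or> b = 13 \<or> b = 15"
      using a b by (simp_all add: lclass_def)
    then show ?thesis using c3 by (elim disjE; simp)
  qed
qed

end

theorem theorem18:
  fixes a13 a14 a23 a24 b13 b14 b23 b24 :: complex
    and d12 d13 d14 d21 d22 d23 d24 u :: complex
  assumes "d21 = 0" and "b13 = 0" and "b14 = 0"
  shows "Hodge (Dirac (mat2 a13 a14 a23 a24) (mat2 b13 b14 b23 b24)
                      (Ymat d12 d13 d14 d21 d22 d23 d24) u) algA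
         \<longleftrightarrow> (b23, b24) \<noteq> (0, 0) \<and>
             3 \<le> length (filter id [(a13, a14) \<noteq> (0, 0), (a23, a24) \<noteq> (0, 0),
                                    (d12, d13, d14) \<noteq> (0, 0, 0), (d22, d23, d24) \<noteq> (0, 0, 0)])"
    (is "Hodge ?D algA \<longleftrightarrow> ?B \<and> ?N")
proof -
  let ?x = "herm (hop [0,0,0,d12,a13,d13,a14,d14] [0,0,0,d22,a23,d23,a24,d24])"
  let ?y = "herm (hop [0,0,0,0,0,0,0,0] [0,0,0,0,b23,0,b24,0])"
  have D: "?D * b - b * ?D = blk (pairf ?x ?y) * b - b * blk (pairf ?x ?y)" if "b \<in> algA" for b
    unfolding assms by (rule Dirac_commutator[OF D0_blk that])
  show ?thesis
  proof
    assume BN: "?B \<and> ?N"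
    show "Hodge ?D algA"
    proof (rule Hodge_if_lunits[OF ClD_subset_blk[OF D]])
      show "lunit a b \<in> ClD ?D algA" if ab: "a \<in> lclass a" "b \<in> lclass a" for a b
      proof (rule lunits_in_Cl[OF D _ _ _ _ ab])
        show "?x 1 s = 0" if "s < 8" for s
          using less_8_cases[OF that] by (elim disjE) (simp_all add: herm_def hop_def)
        show "?y 2 s = 0" if "odd s" "s < 8" for s
          using less_8_cases[OF that(2)] that(1) by (elim disjE) (simp_all add: herm_def hop_def)
        show "?y 2 4 \<noteq> 0 \<or> ?y 2 6 \<noteq> 0"
          using BN by (simp add: herm_def hop_def)
        show "3 \<le> length (filter id [?x 0 4 \<noteq> 0 \<or> ?x 0 6 \<noteq> 0, ?x 2 4 \<noteq> 0 \<or> ?x 2 6 \<noteq> 0,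
            ?x 0 3 \<noteq> 0 \<or> ?x 0 5 \<noteq> 0 \<or> ?x 0 7 \<noteq> 0, ?x 2 3 \<noteq> 0 \<or> ?x 2 5 \<noteq> 0 \<or> ?x 2 7 \<noteq> 0])"
          using BN by (simp add: herm_def hop_def del: filter.simps)
      qed
    qed
  next
    assume Hodge: "Hodge ?D algA"
    note cut = not_Hodge_if_zero_edges[OF D hopf_def[symmetric]]
    show "?B \<and> ?N"
    proof (rule ccontr)
      assume "\<not> (?B \<and> ?N)"
      \<comment> \<open>Fewer than three edges means that some pair among the four vanishes; the
        last six cases list the six pairs.\<close>
      then consider "b23 = 0" "b24 = 0"
        | "a13 = 0" "a14 = 0" "a23 = 0" "a24 = 0"
        | "a13 = 0" "a14 = 0" "d12 = 0" "d13 = 0" "d14 = 0"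
        | "a13 = 0" "a14 = 0" "d22 = 0" "d23 = 0" "d24 = 0"
        | "a23 = 0" "a24 = 0" "d12 = 0" "d13 = 0" "d14 = 0"
        | "a23 = 0" "a24 = 0" "d22 = 0" "d23 = 0" "d24 = 0"
        | "d12 = 0" "d13 = 0" "d14 = 0" "d22 = 0" "d23 = 0" "d24 = 0"
        by (cases "(a13, a14) = (0, 0)"; cases "(a23, a24) = (0, 0)";
            cases "(d12, d13, d14) = (0, 0, 0)"; cases "(d22, d23, d24) = (0, 0, 0)") auto
      then have "\<not> Hodge ?D algA"
      proof cases
        case 1
        then show ?thesis by (intro cut[where S = "{10}" and a = 10 and b = 12]) simp_all
      next
        case 2
        then show ?thesis by (intro cut[where S = "{4, 6}" and a = 4 and b = 0]) simp_all
      next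
        case 3
        then show ?thesis by (intro cut[where S = "{0}" and a = 0 and b = 2]) simp_all
      next
        case 4
        then show ?thesis by (intro cut[where S = "{2, 4, 6}" and a = 2 and b = 0]) simp_all
      next
        case 5
        then show ?thesis by (intro cut[where S = "{0, 4, 6}" and a = 0 and b = 2]) simp_all
      next
        case 6
        then show ?thesis by (intro cut[where S = "{2}" and a = 2 and b = 0]) simp_all
      next
        case 7
        then show ?thesis by (intro cut[where S = "{3, 5, 7}" and a = 3 and b = 0]) simp_all
      qed
      then show False using Hodge by simp
    qed
  qed
qed

end
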